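(* Let $\Phi$ be a Gaussian map on $m$-mode operators, represented by a Gaussian Bargmann function with Abc parametrization $(A_\Phi,b_\Phi,c_\Phi)$ which in type-wise order has the block form $$A_\Phi=\begin{bmatrix}\Lambda_\Phi^*&\Gamma_\Phi\\ \Gamma_\Phi^*&\Lambda_\Phi\end{bmatrix},\qquad b_\Phi=\begin{bmatrix}\beta_\Phi^*\\ \beta_\Phi\end{bmatrix}.$$ Then $\Phi$ is completely positive if and only if $$\Gamma_\Phi\ge0\quad\text{and}\quad c_\Phi\ge0 .$$
   Context: For $z\in\mathbb C^m$, $|z\rangle$ is the $m$-mode coherent state; $^*$ is entrywise complex conjugation; $\Gamma\ge0$ means Hermitian positive semidefinite. The Bargmann function of a linear map $\Phi$ on $m$-mode operators is, in type-wise order of the variables $w,w',z,z'\in\mathbb C^m$, $$F_\Phi(w,w',z,z')=e^{\frac12(\|w\|^2+\|w'\|^2+\|z\|^2+\|z'\|^2)}\langle z^*|\Phi(|z'\rangle\langle w'^*|)|w\rangle ,$$ where $z,w$ are output variables and $z',w'$ are input variables. It is Gaussian if $F_\Phi=c_\Phi\exp(\tfrac12\zeta^{\mathrm T}A_\Phi\zeta+\zeta^{\mathrm T}b_\Phi)$ with $\zeta=(w,w',z,z')$, where $A_\Phi\in\mathbb C^{4m\times4m}$ is complex symmetric (not necessarily Hermitian) with eigenvalues in the unit disk, $b_\Phi\in\mathbb C^{4m}$ is a complex vector and $c_\Phi$ is a complex scalar; $(A_\Phi,b_\Phi,c_\Phi)$ is the Abc parametrization. The blocks $\Lambda_\Phi,\Gamma_\Phi$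 are $2m\times2m$ and $\beta_\Phi\in\mathbb C^{2m}$. Complete positivity of $\Phi$ is equivalent to positivity of its Choi operator $(\mathcal I\otimes\Phi)[|\mathrm{EPR}\rangle\langle\mathrm{EPR}|]$, with $|\mathrm{EPR}\rangle=\sum_n|n\rangle|n\rangle$ the (unnormalized) maximally entangled state in the Fock basis.
   Formalization: The scalar c_Φ is assumed nonzero (for Φ = 0 the data A, b are arbitrary and the claim fails), and the linear map Φ is taken to be bounded from trace-class to bounded operators, since without continuity its Bargmann function does not determine it. *)

theory Defs
  imports "HOL-Analysis.Analysis" "HOL-Library.Complex_Order"
begin

text \<open>
  The number of modes is the cardinality of the finite index type \<open>'m\<close>. A state vector is given
  by its coefficients in the Fock basis, which is indexed by the occupation numbers
  \<open>n :: nat ^ 'm\<close>.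
\<close>

typedef ('m::finite) fock =
  "{\<psi> :: nat ^ 'm \<Rightarrow> complex. (\<lambda>n. (cmod (\<psi> n))\<^sup>2) summable_on UNIV}"
  morphisms fock_coeff Abs_fock
  by (rule exI[of _ "\<lambda>_. 0"]) simp

setup_lifting type_definition_fock

lemma square_summable_add:
  fixes f g :: "'a \<Rightarrow> complex"
  assumes "(\<lambda>n. (cmod (f n))\<^sup>2) summable_on UNIV" "(\<lambda>n. (cmod (g n))\<^sup>2) summable_on UNIV"
  shows "(\<lambda>n. (cmod (f n + g n))\<^sup>2) summable_on UNIV"
proof (rule summable_on_comparison_test)
  show "(\<lambda>n. 2 * (cmod (f n))\<^sup>2 + 2 * (cmod (g n))\<^sup>2) summable_on UNIV"
    by (intro summable_on_add summable_on_cmult_right assms)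
  show "(cmod (f n + g n))\<^sup>2 \<le> 2 * (cmod (f n))\<^sup>2 + 2 * (cmod (g n))\<^sup>2" for n
  proof -
    have "(cmod (f n + g n))\<^sup>2 \<le> (cmod (f n) + cmod (g n))\<^sup>2"
      by (intro power_mono norm_triangle_ineq) auto
    also have "\<dots> \<le> 2 * (cmod (f n))\<^sup>2 + 2 * (cmod (g n))\<^sup>2"
      using sum_squares_bound[of "cmod (f n)" "cmod (g n)"] by (simp add: power2_sum)
    finally show ?thesis .
  qed
qed auto

lemma square_summable_scale:
  fixes f :: "'a \<Rightarrow> complex"
  assumes "(\<lambda>n. (cmod (f n))\<^sup>2) summable_on UNIV"
  shows "(\<lambda>n. (cmod (c * f n))\<^sup>2) summable_on UNIV"
  using summable_on_cmult_right[OF assms, of "(cmod c)\<^sup>2"]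
  by (simp add: norm_mult power_mult_distrib)

lemma square_summable_product:
  fixes f g :: "'a \<Rightarrow> complex"
  assumes "(\<lambda>n. (cmod (f n))\<^sup>2) summable_on UNIV" "(\<lambda>n. (cmod (g n))\<^sup>2) summable_on UNIV"
  shows "(\<lambda>n. cnj (f n) * g n) summable_on UNIV"
proof (rule abs_summable_summable, rule abs_summable_product)
  show "(\<lambda>n. norm (cnj (f n) * cnj (f n))) summable_on UNIV"
    using assms(1) by (simp add: norm_mult power2_eq_square)
  show "(\<lambda>n. norm (g n * g n)) summable_on UNIV"
    using assms(2) by (simp add: norm_mult power2_eq_square)
qed

lift_definition cscale :: "complex \<Rightarrow> 'm::finite fock \<Rightarrow> 'm fock"
  is "\<lambda>c \<psi> n. c * \<psi> n"
  by (rule square_summable_scale)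

lift_definition cinner :: "'m::finite fock \<Rightarrow> 'm fock \<Rightarrow> complex"
  is "\<lambda>\<phi> \<psi>. \<Sum>\<^sub>\<infinity>n. cnj (\<phi> n) * \<psi> n" .

instantiation fock :: (finite) real_vector
begin

lift_definition zero_fock :: "'a fock" is "\<lambda>_. 0" by simp

lift_definition plus_fock :: "'a fock \<Rightarrow> 'a fock \<Rightarrow> 'a fock" is "\<lambda>\<phi> \<psi> n. \<phi> n + \<psi> n"
  by (rule square_summable_add)

lift_definition uminus_fock :: "'a fock \<Rightarrow> 'a fock" is "\<lambda>\<psi> n. - \<psi> n" by simp

lift_definition minus_fock :: "'a fock \<Rightarrow> 'a fock \<Rightarrow> 'a fock" is "\<lambda>\<phi> \<psi> n. \<phi> n - \<psi> n"
  subgoal for f g using square_summable_add[of f "\<lambda>n. - g n"] by simp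
  done

lift_definition scaleR_fock :: "real \<Rightarrow> 'a fock \<Rightarrow> 'a fock" is "\<lambda>r \<psi> n. complex_of_real r * \<psi> n"
  by (rule square_summable_scale)

instance
proof
  fix x y z :: "'a fock" and r s :: real
  show "x + y + z = x + (y + z)" by transfer (simp add: algebra_simps)
  show "x + y = y + x" by transfer (simp add: algebra_simps)
  show "0 + x = x" by transfer simp
  show "- x + x = 0" by transfer simp
  show "x - y = x + - y" by transfer simp
  show "r *\<^sub>R (x + y) = r *\<^sub>R x + r *\<^sub>R y" by transfer (simp add: algebra_simps)
  show "(r + s) *\<^sub>R x = r *\<^sub>R x + s *\<^sub>R x" by transfer (simp add: algebra_simps)
  show "r *\<^sub>R s *\<^sub>R x = (r * s) *\<^sub>R x" by transfer (simp add: algebra_simps)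
  show "1 *\<^sub>R x = x" by transfer simp
qed

end

instantiation fock :: (finite) real_inner
begin

definition inner_fock :: "'a fock \<Rightarrow> 'a fock \<Rightarrow> real"
  where "inner_fock \<phi> \<psi> = Re (cinner \<phi> \<psi>)"

definition norm_fock :: "'a fock \<Rightarrow> real"
  where "norm_fock \<psi> = sqrt (\<psi> \<bullet> \<psi>)"

definition sgn_fock :: "'a fock \<Rightarrow> 'a fock"
  where "sgn_fock \<psi> = \<psi> /\<^sub>R norm \<psi>"

definition dist_fock :: "'a fock \<Rightarrow> 'a fock \<Rightarrow> real"
  where "dist_fock \<phi> \<psi> = norm (\<phi> - \<psi>)"

definition uniformity_fock :: "('a fock \<times> 'a fock) filter"
  where "uniformity_fock = (INF e\<in>{0 <..}. principal {(\<phi>, \<psi>). dist \<phi> \<psi> < e})"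

definition open_fock :: "'a fock set \<Rightarrow> bool"
  where "open_fock U = (\<forall>x\<in>U. \<forall>\<^sub>F (x', y) in uniformity. x' = x \<longrightarrow> y \<in> U)"

instance
proof
  fix x y z :: "'a fock" and r :: real
  show "sgn x = x /\<^sub>R norm x" by (fact sgn_fock_def)
  show "dist x y = norm (x - y)" by (fact dist_fock_def)
  show "uniformity = (INF e\<in>{0 <..}. principal {(x :: 'a fock, y). dist x y < e})"
    by (fact uniformity_fock_def)
  show "open U = (\<forall>x\<in>U. \<forall>\<^sub>F (x', y) in uniformity. x' = x \<longrightarrow> y \<in> U)" for U :: "'a fock set"
    by (fact open_fock_def)
  show "norm x = sqrt (x \<bullet> x)" by (fact norm_fock_def)
  have "cinner y x = cnj (cinner x y)"
    by transfer (simp add: infsum_cnj[symmetric] mult.commute)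
  then show "x \<bullet> y = y \<bullet> x" by (simp add: inner_fock_def)
  have "cinner (x + y) z = cinner x z + cinner y z"
    by transfer (simp add: distrib_right infsum_add square_summable_product)
  then show "(x + y) \<bullet> z = x \<bullet> z + y \<bullet> z" by (simp add: inner_fock_def)
  have "cinner (r *\<^sub>R x) y = complex_of_real r * cinner x y"
    by transfer (simp add: mult.assoc infsum_cmult_right')
  then show "(r *\<^sub>R x) \<bullet> y = r * (x \<bullet> y)" by (simp add: inner_fock_def)
  have self: "cinner x x = complex_of_real (\<Sum>\<^sub>\<infinity>n. (cmod (fock_coeff x n))\<^sup>2)"
  proof -
    have "cinner x x = (\<Sum>\<^sub>\<infinity>n. complex_of_real ((cmod (fock_coeff x n))\<^sup>2))"
      by transfer (intro infsum_cong, metis complex_norm_square mult.commute of_real_power)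
    also have "\<dots> = complex_of_real (\<Sum>\<^sub>\<infinity>n. (cmod (fock_coeff x n))\<^sup>2)"
      using fock_coeff[of x] by (intro infsumI has_sum_of_real has_sum_infsum) simp
    finally show ?thesis .
  qed
  show "0 \<le> x \<bullet> x" by (simp add: inner_fock_def self infsum_nonneg)
  show "(x \<bullet> x = 0) = (x = 0)"
  proof
    assume "x \<bullet> x = 0"
    then have "(\<Sum>\<^sub>\<infinity>n. (cmod (fock_coeff x n))\<^sup>2) \<le> 0"
      by (simp add: inner_fock_def self)
    then have "(cmod (fock_coeff x n))\<^sup>2 = 0" for n
      using fock_coeff[of x] by (intro nonneg_infsum_le_0D[where A = UNIV]) auto
    then show "x = 0" by (simp add: fock_coeff_inject[symmetric] zero_fock.rep_eq fun_eq_iff)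
  next
    assume "x = 0"
    moreover have "cinner (0 :: 'a fock) 0 = 0" by transfer simp
    ultimately show "x \<bullet> x = 0" by (simp add: inner_fock_def)
  qed
qed

end

lemma coherent_square_summable:
  fixes z :: "complex ^ 'm::finite"
  shows "(\<lambda>n :: nat ^ 'm. (cmod (c * (\<Prod>i\<in>UNIV. z $ i ^ (n $ i) / complex_of_real (sqrt (fact (n $ i))))))\<^sup>2)
    summable_on UNIV"
proof (rule square_summable_scale)
  define f where "f i k = (cmod (z $ i))\<^sup>2 ^ k / fact k" for i k
  have "summable (\<lambda>k. norm (f i k))" for i
    using summable_exp[of "(cmod (z $ i))\<^sup>2"] by (simp add: f_def divide_inverse mult.commute)
  then have "(\<lambda>k. norm (f i k)) summable_on (UNIV :: nat set)" for i
    by (simp add: summable_on_UNIV_nonneg_real_iff)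
  then have "Infinite_Set_Sum.abs_summable_on (f i) UNIV" for i
    by (subst abs_summable_equivalent[symmetric])
  then have "Infinite_Set_Sum.abs_summable_on (\<lambda>g. \<Prod>i\<in>UNIV. f i (g i)) (PiE UNIV (\<lambda>_::'m. UNIV))"
    by (intro Infinite_Set_Sum.abs_summable_on_prod_PiE) (auto simp: f_def)
  then have "(\<lambda>g. \<Prod>i\<in>UNIV. f i (g i)) summable_on (UNIV :: ('m \<Rightarrow> nat) set)"
    unfolding abs_summable_equivalent[symmetric] PiE_UNIV_domain Pi_UNIV
    by (rule abs_summable_summable)
  moreover have "bij (vec_nth :: nat ^ 'm \<Rightarrow> _)"
    by (rule bij_betw_byWitness[where f' = vec_lambda]) (auto simp: vec_lambda_beta fun_eq_iff)
  ultimately have "(\<lambda>n :: nat ^ 'm. \<Prod>i\<in>UNIV. f i (n $ i)) summable_on UNIV"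
    using summable_on_reindex_bij_betw[of "vec_nth :: nat ^ 'm \<Rightarrow> _" UNIV UNIV
        "\<lambda>g. \<Prod>i\<in>UNIV. f i (g i)"] by simp
  moreover have "(cmod (\<Prod>i\<in>UNIV. z $ i ^ (n $ i) / complex_of_real (sqrt (fact (n $ i)))))\<^sup>2
      = (\<Prod>i\<in>UNIV. f i (n $ i))" for n :: "nat ^ 'm"
    by (simp add: f_def norm_divide norm_power prod_norm[symmetric] power_divide prod_power_distrib
        power_mult[symmetric] mult.commute)
  ultimately show "(\<lambda>n :: nat ^ 'm.
      (cmod (\<Prod>i\<in>UNIV. z $ i ^ (n $ i) / complex_of_real (sqrt (fact (n $ i)))))\<^sup>2) summable_on UNIV"
    by simp
qed

lift_definition coherent :: "complex ^ 'm::finite \<Rightarrow> 'm fock"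
  is "\<lambda>z n. complex_of_real (exp (- (norm z)\<^sup>2 / 2)) *
        (\<Prod>i\<in>UNIV. z $ i ^ (n $ i) / complex_of_real (sqrt (fact (n $ i))))"
  by (rule coherent_square_summable)

type_synonym 'm operator = "'m fock \<Rightarrow> 'm fock"

definition bounded_operator :: "'m::finite operator \<Rightarrow> bool"
  where "bounded_operator T \<longleftrightarrow>
    bounded_linear T \<and> (\<forall>c \<psi>. T (cscale c \<psi>) = cscale c (T \<psi>))"

definition ketbra :: "'m::finite fock \<Rightarrow> 'm fock \<Rightarrow> 'm operator"
  where "ketbra \<phi> \<psi> = (\<lambda>\<xi>. cscale (cinner \<psi> \<xi>) \<phi>)"

text \<open>
  The trace class is introduced as the nuclear operators
  \<open>T = (\<Sum>j. |a j\<rangle>\<langle>b j|)\<close> with \<open>(\<Sum>j. \<parallel>a j\<parallel> \<parallel>b j\<parallel>) < \<infinity>\<close>, and the trace norm as the infimum of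
  these sums; on a Hilbert space both agree with the definition by way of \<open>tr |T|\<close>.
\<close>

definition nuclear_rep ::
    "'m::finite operator \<Rightarrow> (nat \<Rightarrow> 'm fock) \<Rightarrow> (nat \<Rightarrow> 'm fock) \<Rightarrow> bool"
  where "nuclear_rep T a b \<longleftrightarrow>
    summable (\<lambda>j. norm (a j) * norm (b j)) \<and> (\<forall>\<psi>. (\<lambda>j. ketbra (a j) (b j) \<psi>) sums T \<psi>)"

definition trace_class :: "'m::finite operator \<Rightarrow> bool"
  where "trace_class T \<longleftrightarrow> (\<exists>a b. nuclear_rep T a b)"

definition trace_norm :: "'m::finite operator \<Rightarrow> real"
  where "trace_norm T = Inf {\<Sum>j. norm (a j) * norm (b j) | a b. nuclear_rep T a b}"

text \<open>
  A linear map on m-mode operators is a bounded linear map from the trace class to the bounded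
  operators. This contains the bounded linear maps of the trace class into itself, since the
  operator norm is at most the trace norm. Only the values on the trace class are relevant.
\<close>

definition superoperator :: "('m::finite operator \<Rightarrow> 'm operator) \<Rightarrow> bool"
  where "superoperator \<Phi> \<longleftrightarrow>
    (\<forall>\<rho>. trace_class \<rho> \<longrightarrow> bounded_operator (\<Phi> \<rho>)) \<and>
    (\<forall>\<rho> \<sigma>. trace_class \<rho> \<and> trace_class \<sigma> \<longrightarrow>
      \<Phi> (\<lambda>\<psi>. \<rho> \<psi> + \<sigma> \<psi>) = (\<lambda>\<psi>. \<Phi> \<rho> \<psi> + \<Phi> \<sigma> \<psi>)) \<and>
    (\<forall>c \<rho>. trace_class \<rho> \<longrightarrow>
      \<Phi> (\<lambda>\<psi>. cscale c (\<rho> \<psi>)) = (\<lambda>\<psi>. cscale c (\<Phi> \<rho> \<psi>))) \<and>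
    (\<exists>C. \<forall>\<rho> \<psi>. trace_class \<rho> \<longrightarrow> norm (\<Phi> \<rho> \<psi>) \<le> C * trace_norm \<rho> * norm \<psi>)"

text \<open>
  An \<open>n \<times> n\<close> array of operators acts on the n-fold direct sum of the Hilbert space, that is, on
  its tensor product with \<open>\<complex>\<^sup>n\<close>; complete positivity is positivity of \<open>id\<^sub>n \<otimes> \<Phi>\<close> for all n.
\<close>

definition block_positive :: "nat \<Rightarrow> (nat \<Rightarrow> nat \<Rightarrow> 'm::finite operator) \<Rightarrow> bool"
  where "block_positive n R \<longleftrightarrow>
    (\<forall>\<psi>. 0 \<le> (\<Sum>i<n. \<Sum>j<n. cinner (\<psi> i) (R i j (\<psi> j))))"

definition completely_positive :: "('m::finite operator \<Rightarrow> 'm operator) \<Rightarrow> bool"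
  where "completely_positive \<Phi> \<longleftrightarrow>
    (\<forall>n R. (\<forall>i<n. \<forall>j<n. trace_class (R i j)) \<and> block_positive n R \<longrightarrow>
      block_positive n (\<lambda>i j. \<Phi> (R i j)))"

definition vec_cnj :: "complex ^ 'n \<Rightarrow> complex ^ 'n"
  where "vec_cnj v = (\<chi> i. cnj (v $ i))"

abbreviation mat_cnj :: "complex ^ 'n ^ 'k \<Rightarrow> complex ^ 'n ^ 'k"
  where "mat_cnj \<equiv> map_matrix cnj"

definition vec_join :: "'a ^ 'n \<Rightarrow> 'a ^ 'k \<Rightarrow> 'a ^ ('n::finite + 'k::finite)"
  where "vec_join u v = (\<chi> i. case i of Inl k \<Rightarrow> u $ k | Inr k \<Rightarrow> v $ k)"

definition mat_block ::
    "'a ^ 'n ^ 'k \<Rightarrow> 'a ^ 'l ^ 'k \<Rightarrow> 'a ^ 'n ^ 'j \<Rightarrow> 'a ^ 'l ^ 'j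
      \<Rightarrow> 'a ^ ('n::finite + 'l::finite) ^ ('k::finite + 'j::finite)"
  where "mat_block P Q R S =
    (\<chi> i. case i of Inl k \<Rightarrow> vec_join (P $ k) (Q $ k) | Inr k \<Rightarrow> vec_join (R $ k) (S $ k))"

definition positive_semidefinite :: "complex ^ 'n ^ 'n \<Rightarrow> bool"
  where "positive_semidefinite M \<longleftrightarrow>
    transpose (mat_cnj M) = M \<and>
    (\<forall>v. 0 \<le> (\<Sum>i\<in>UNIV. \<Sum>j\<in>UNIV. cnj (v $ i) * M $ i $ j * v $ j))"

definition bilin :: "complex ^ 'n \<Rightarrow> complex ^ 'n \<Rightarrow> complex"
  where "bilin u v = (\<Sum>i\<in>UNIV. u $ i * v $ i)"

definition bargmann :: "('m::finite operator \<Rightarrow> 'm operator) \<Rightarrow>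
    complex ^ 'm \<Rightarrow> complex ^ 'm \<Rightarrow> complex ^ 'm \<Rightarrow> complex ^ 'm \<Rightarrow> complex"
  where "bargmann \<Phi> w w' z z' =
    complex_of_real (exp (((norm w)\<^sup>2 + (norm w')\<^sup>2 + (norm z)\<^sup>2 + (norm z')\<^sup>2) / 2)) *
    cinner (coherent (vec_cnj z)) (\<Phi> (ketbra (coherent z') (coherent (vec_cnj w'))) (coherent w))"

text \<open>
  The argument \<open>(w, w', z, z')\<close> is indexed by \<open>('m + 'm) + ('m + 'm)\<close>, so that the blocks of size
  twice the number of modes are indexed by \<open>'m + 'm\<close>. The unit disk is the closed one: the
  identity map has the eigenvalues \<open>1\<close> and \<open>-1\<close>.
\<close>

definition abc_parametrization :: "('m::finite operator \<Rightarrow> 'm operator) \<Rightarrow>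
    complex ^ (('m + 'm) + ('m + 'm)) ^ (('m + 'm) + ('m + 'm)) \<Rightarrow>
    complex ^ (('m + 'm) + ('m + 'm)) \<Rightarrow> complex \<Rightarrow> bool"
  where "abc_parametrization \<Phi> A b c \<longleftrightarrow>
    transpose A = A \<and>
    (\<forall>\<mu> v. v \<noteq> 0 \<and> A *v v = \<mu> *s v \<longrightarrow> cmod \<mu> \<le> 1) \<and>
    (\<forall>w w' z z'. let \<zeta> = vec_join (vec_join w w') (vec_join z z') in
      bargmann \<Phi> w w' z z' = c * exp (bilin \<zeta> (A *v \<zeta>) / 2 + bilin \<zeta> b))"

end

theory Submission
  imports Defs
begin

text \<open>
  Complete positivity of \<open>\<Phi>\<close> means that \<open>K((\<psi>, \<phi>), (\<psi>', \<phi>')) = \<langle>\<psi>|\<Phi>(|\<phi>\<rangle>\<langle>\<phi>'|)|\<psi>'\<rangle>\<close> is a positive semidefinite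
  kernel: a positive array of trace class operators, cut off to finitely many Fock states, is a
  positive semidefinite matrix, its image under \<open>\<Phi>\<close> is paired with \<open>K\<close> entrywise, and the Schur product
  theorem applies; the cut-off converges in trace norm. Since the span of the coherent states is
  dense, it suffices to test \<open>K\<close> on coherent states. There the Abc form gives
  \<open>K(s, t) = d(s)\<^sup>* c exp(v\<^sub>t\<^sup>\<dagger> \<Gamma> v\<^sub>s) d(t)\<close> with \<open>d\<close> nowhere zero, and the vectors \<open>v\<^sub>s\<close> run through all of
  \<open>\<complex>\<^sup>2\<^sup>m\<close>. If \<open>\<Gamma> \<ge> 0\<close> and \<open>c \<ge> 0\<close>, this kernel is positive by the Schur product theorem once more. Conversely,
  the point \<open>0\<close> gives \<open>c \<ge> 0\<close>, and the points \<open>0, v\<close> with weights \<open>-1, 1\<close> give \<open>exp(v\<^sup>\<dagger> \<Gamma> v) \<ge> 1\<close>.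
\<close>

subsection \<open>Positive semidefinite kernels\<close>

text \<open>In the order on complex numbers \<open>0 \<le> z\<close> includes
  \<open>Im z = 0\<close>, so this definition already forces Hermitian symmetry, as extracted in
  \<open>psd_kernel_hermitian\<close>. The carrier may be infinite, such as all pairs of state
  vectors.\<close>

definition psd_kernel :: "'i set \<Rightarrow> ('i \<Rightarrow> 'i \<Rightarrow> complex) \<Rightarrow> bool"
  where "psd_kernel X K \<longleftrightarrow> (\<forall>S x. finite S \<and> S \<subseteq> X \<longrightarrow>
    0 \<le> (\<Sum>s\<in>S. \<Sum>t\<in>S. cnj (x s) * K s t * x t))"

lemma psd_kernelD:
  "psd_kernel X K \<Longrightarrow> finite S \<Longrightarrow> S \<subseteq> X \<Longrightarrow> 0 \<le> (\<Sum>s\<in>S. \<Sum>t\<in>S. cnj (x s) * K s t * x t)"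
  by (auto simp: psd_kernel_def)

lemma psd_kernel_subset: "psd_kernel X K \<Longrightarrow> Y \<subseteq> X \<Longrightarrow> psd_kernel Y K"
  unfolding psd_kernel_def by blast

lemma complex_of_real_nonneg_iff: "0 \<le> complex_of_real r \<longleftrightarrow> 0 \<le> r"
  by (simp add: less_eq_complex_def)

lemma psd_kernel_pair:
  assumes K: "psd_kernel X K" and st: "s \<in> X" "t \<in> X" "s \<noteq> t"
  shows "0 \<le> cnj a * K s s * a + cnj a * K s t * b + cnj b * K t s * a + cnj b * K t t * b"
  using psd_kernelD[OF K, of "{s, t}" "\<lambda>i. if i = s then a else b"] st
  by (simp add: add.assoc)

lemma psd_kernel_diag: "psd_kernel X K \<Longrightarrow> s \<in> X \<Longrightarrow> 0 \<le> K s s"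
  using psd_kernelD[of X K "{s}" "\<lambda>_. 1"] by simp

text \<open>Polarization: reality of the form at the weights \<open>(1, 1)\<close> compares the
  imaginary parts of \<open>K s t\<close> and \<open>K t s\<close>, and reality at
  \<open>(1, \<i>)\<close> compares the real parts.\<close>

lemma psd_kernel_hermitian:
  assumes K: "psd_kernel X K" and st: "s \<in> X" "t \<in> X"
  shows "K t s = cnj (K s t)"
proof (cases "s = t")
  case True
  then show ?thesis
    using psd_kernel_diag[OF K st(1)] by (simp add: complex_eq_iff less_eq_complex_def)
next
  case False
  have "Im (K s s) = 0" "Im (K t t) = 0"
    using psd_kernel_diag[OF K] st by (simp_all add: less_eq_complex_def)
  then show ?thesis
    using psd_kernel_pair[OF K st False, of 1 1] psd_kernel_pair[OF K st False, of 1 \<i>]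
    by (simp add: complex_eq_iff less_eq_complex_def)
qed

text \<open>With \<open>K s s = 0\<close> the two-point form is affine in the weight at
  \<open>s\<close>; a nonzero \<open>K s t\<close> would let it take negative values.\<close>

lemma psd_kernel_zero_row:
  assumes K: "psd_kernel X K" and st: "s \<in> X" "t \<in> X" and 0: "K s s = 0"
  shows "K s t = 0"
proof (rule ccontr)
  assume nz: "K s t \<noteq> 0"
  then have "s \<noteq> t" using 0 by auto
  \<comment> \<open>The weights \<open>- (r / q) * K s t\<close> at \<open>s\<close> and
    \<open>1\<close> at \<open>t\<close> give the form the value \<open>K t t - 2 * r\<close>. This
    choice of \<open>r\<close> makes it \<open>- K t t - 2\<close>, which is negative.\<close>
  define r where "r = Re (K t t) + 1"
  define q where "q = (cmod (K s t))\<^sup>2"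
  have q: "q > 0" using nz by (simp add: q_def)
  have eq: "cnj (K s t) * K s t = complex_of_real q"
    by (metis q_def complex_norm_square mult.commute)
  have "0 \<le> cnj (- complex_of_real (r / q) * K s t) * K s t +
      cnj (K s t) * (- complex_of_real (r / q) * K s t) + K t t"
    using psd_kernel_pair[OF K st \<open>s \<noteq> t\<close>, of "- complex_of_real (r / q) * K s t" 1]
    by (simp add: 0 psd_kernel_hermitian[OF K st])
  also have "\<dots> = - 2 * complex_of_real (r / q) * (cnj (K s t) * K s t) + K t t"
    by (simp add: algebra_simps)
  also have "\<dots> = - 2 * complex_of_real r + K t t"
    using q unfolding eq by simp
  finally have "0 \<le> - 2 * r + Re (K t t)" by (simp add: less_eq_complex_def)
  moreover have "0 \<le> Re (K t t)" using psd_kernel_diag[OF K st(2)] by (simp add: less_eq_complex_def)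
  ultimately show False by (simp add: r_def)
qed

text \<open>Completing the square: the form of the complement at \<open>x\<close> is the form of
  \<open>K\<close> at an extension of \<open>x\<close> to the point \<open>s\<close>.\<close>

lemma psd_kernel_Schur_complement:
  assumes K: "psd_kernel (insert s X) K" and s: "s \<notin> X" and nz: "K s s \<noteq> 0"
  shows "psd_kernel X (\<lambda>t u. K t u - K t s * K s u / K s s)"
  unfolding psd_kernel_def
proof (intro allI impI, elim conjE)
  fix S x assume S: "finite S" "S \<subseteq> X"
  then have sS: "s \<notin> S" using s by auto
  define m where "m = K s s"
  define \<xi> where "\<xi> = (\<Sum>t\<in>S. K s t * x t)"
  define \<eta> where "\<eta> = (\<Sum>t\<in>S. cnj (x t) * K t s)"
  define Q where "Q = (\<Sum>t\<in>S. \<Sum>u\<in>S. cnj (x t) * K t u * x u)"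
  have herm: "K t s = cnj (K s t)" if "t \<in> S" for t
    using psd_kernel_hermitian[OF K] that S by auto
  have cm: "cnj m = m"
    using psd_kernel_hermitian[OF K, of s s] by (simp add: m_def)
  have \<eta>: "\<eta> = cnj \<xi>" by (simp add: \<eta>_def \<xi>_def herm mult.commute)
  \<comment> \<open>The value \<open>- \<xi> / m\<close> at \<open>s\<close> minimizes the form of
    \<open>K\<close> over the weight at \<open>s\<close> and leaves
    \<open>Q - \<eta> * \<xi> / m\<close>.\<close>
  define y where "y i = (if i = s then - \<xi> / m else x i)" for i
  have "0 \<le> (\<Sum>t\<in>insert s S. \<Sum>u\<in>insert s S. cnj (y t) * K t u * y u)"
    using S by (intro psd_kernelD[OF K]) auto
  also have "\<dots> = (\<Sum>u\<in>insert s S. cnj (y s) * K s u * y u)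
      + (\<Sum>t\<in>S. \<Sum>u\<in>insert s S. cnj (y t) * K t u * y u)"
    using S sS by simp
  also have "(\<Sum>u\<in>insert s S. cnj (y s) * K s u * y u) = cnj (y s) * m * y s + cnj (y s) * \<xi>"
  proof -
    have "(\<Sum>u\<in>S. K s u * y u) = \<xi>"
      using sS unfolding \<xi>_def by (intro sum.cong) (auto simp: y_def)
    then show ?thesis
      using S sS by (simp add: m_def mult.assoc sum_distrib_left[symmetric] distrib_left)
  qed
  also have "(\<Sum>t\<in>S. \<Sum>u\<in>insert s S. cnj (y t) * K t u * y u) = \<eta> * y s + Q"
  proof -
    have "(\<Sum>u\<in>insert s S. cnj (y t) * K t u * y u)
        = cnj (x t) * K t s * y s + (\<Sum>u\<in>S. cnj (x t) * K t u * x u)" if "t \<in> S" for t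
    proof -
      have "(\<Sum>u\<in>S. cnj (y t) * K t u * y u) = (\<Sum>u\<in>S. cnj (x t) * K t u * x u)"
        using sS that by (intro sum.cong) (auto simp: y_def)
      moreover have "y t = x t" using sS that by (auto simp: y_def)
      ultimately show ?thesis using S sS by simp
    qed
    then show ?thesis by (simp add: \<eta>_def Q_def sum.distrib sum_distrib_right)
  qed
  also have "cnj (y s) * m * y s + cnj (y s) * \<xi> + (\<eta> * y s + Q) = Q - \<eta> * \<xi> / m"
    using nz unfolding m_def[symmetric] by (simp add: y_def cm \<eta> field_simps)
  also have "\<dots> = (\<Sum>t\<in>S. \<Sum>u\<in>S. cnj (x t) * (K t u - K t s * K s u / K s s) * x u)"
    unfolding Q_def \<eta>_def \<xi>_def m_def sum_product sum_divide_distrib sum_subtractf[symmetric]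
    by (intro sum.cong refl) (simp add: algebra_simps)
  finally show "0 \<le> (\<Sum>t\<in>S. \<Sum>u\<in>S. cnj (x t) * (K t u - K t s * K s u / K s s) * x u)" .
qed

text \<open>The Schur product theorem at weights 1, by elimination of one point at a time:
  \<open>K\<close> is the sum of a rank one kernel and the Schur complement at \<open>s\<close>. The
  rank one part pairs with \<open>L\<close> to a value of the form of \<open>L\<close>; the
  complement vanishes in the row and column of \<open>s\<close> and falls under the induction
  hypothesis.\<close>

lemma Schur_sum_nonneg:
  assumes "finite S" "psd_kernel S K" "psd_kernel S L"
  shows "0 \<le> (\<Sum>s\<in>S. \<Sum>t\<in>S. K s t * L s t)"
  using assms
proof (induction S arbitrary: K rule: finite_induct)
  case empty
  then show ?case by simp
next
  case (insert s S)
  note K = insert.prems(1) and L = insert.prems(2)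
  have LS: "psd_kernel S L" by (rule psd_kernel_subset[OF L]) auto
  have restrict: "(\<Sum>t\<in>insert s S. \<Sum>u\<in>insert s S. M t u * L t u) = (\<Sum>t\<in>S. \<Sum>u\<in>S. M t u * L t u)"
    if "\<And>t. t \<in> insert s S \<Longrightarrow> M s t = 0" "\<And>t. t \<in> insert s S \<Longrightarrow> M t s = 0" for M
    using that insert.hyps by (simp add: sum.neutral)
  show ?case
  proof (cases "K s s = 0")
    case True
    have row: "K s t = 0" if "t \<in> insert s S" for t
      using psd_kernel_zero_row[OF K _ that True] by simp
    moreover have "K t s = 0" if "t \<in> insert s S" for t
      using psd_kernel_hermitian[OF K _ that, of s] row[OF that] by simp
    ultimately show ?thesis
      using restrict[of K] insert.IH[OF _ LS] psd_kernel_subset[OF K, of S] by auto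
  next
    case False
    define m where "m = K s s"
    define M where "M t u = K t u - K t s * K s u / K s s" for t u
    have "psd_kernel S M"
      unfolding M_def by (rule psd_kernel_Schur_complement[OF K insert.hyps(2) False])
    then have 1: "0 \<le> (\<Sum>t\<in>S. \<Sum>u\<in>S. M t u * L t u)"
      by (rule insert.IH[OF _ LS])
    have 2: "0 \<le> (\<Sum>t\<in>insert s S. \<Sum>u\<in>insert s S. cnj (K s t) * L t u * K s u)"
      using insert.hyps by (intro psd_kernelD[OF L]) auto
    have m: "0 \<le> 1 / m"
    proof -
      have "m = complex_of_real (Re m)" "0 \<le> Re m"
        using psd_kernel_diag[OF K, of s] by (simp_all add: m_def less_eq_complex_def complex_eq_iff)
      then show ?thesis
        by (metis complex_of_real_nonneg_iff divide_nonneg_nonneg of_real_1 of_real_divide zero_le_one)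
    qed
    \<comment> \<open>Hermitian symmetry turns the rank one part \<open>K t s * K s u / m\<close>
      into \<open>cnj (K s t) * K s u / m\<close>, so that \<open>K s t\<close> serves as a weight
      for \<open>L\<close>.\<close>
    have "(\<Sum>t\<in>insert s S. \<Sum>u\<in>insert s S. K t u * L t u)
        = (\<Sum>t\<in>insert s S. \<Sum>u\<in>insert s S. M t u * L t u
            + 1 / m * (cnj (K s t) * L t u * K s u))"
    proof (intro sum.cong refl)
      fix t u assume "t \<in> insert s S"
      then have "K t s = cnj (K s t)" by (intro psd_kernel_hermitian[OF K]) auto
      then have "M t u = K t u - cnj (K s t) * K s u / m" by (simp add: M_def m_def)
      then show "K t u * L t u = M t u * L t u + 1 / m * (cnj (K s t) * L t u * K s u)"
        by (simp only:) (simp add: algebra_simps)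
    qed
    also have "\<dots> = (\<Sum>t\<in>insert s S. \<Sum>u\<in>insert s S. M t u * L t u)
        + 1 / m * (\<Sum>t\<in>insert s S. \<Sum>u\<in>insert s S. cnj (K s t) * L t u * K s u)"
      by (simp only: sum.distrib sum_distrib_left)
    also have "(\<Sum>t\<in>insert s S. \<Sum>u\<in>insert s S. M t u * L t u) = (\<Sum>t\<in>S. \<Sum>u\<in>S. M t u * L t u)"
      using False by (intro restrict) (simp_all add: M_def)
    finally show ?thesis
      using add_nonneg_nonneg[OF 1 mult_nonneg_nonneg[OF m 2]] by (simp only:)
  qed
qed

section \<open>Operations that preserve positive semidefiniteness of kernels\<close>

lemma psd_kernel_scale:
  assumes "psd_kernel X K"
  shows "psd_kernel X (\<lambda>s t. cnj (d s) * K s t * d t)"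
  unfolding psd_kernel_def
proof (intro allI impI, elim conjE)
  fix S x assume "finite S" "S \<subseteq> X"
  from psd_kernelD[OF assms this, of "\<lambda>s. d s * x s"]
  show "0 \<le> (\<Sum>s\<in>S. \<Sum>t\<in>S. cnj (x s) * (cnj (d s) * K s t * d t) * x t)"
    by (simp add: mult_ac)
qed

text \<open>Arbitrary weights are absorbed into \<open>K\<close> by \<open>psd_kernel_scale\<close>,
  which reduces the claim to weights 1.\<close>

lemma psd_kernel_mult:
  assumes "psd_kernel X K" "psd_kernel X L"
  shows "psd_kernel X (\<lambda>s t. K s t * L s t)"
  unfolding psd_kernel_def
proof (intro allI impI, elim conjE)
  fix S x assume S: "finite S" "S \<subseteq> X"
  have "0 \<le> (\<Sum>s\<in>S. \<Sum>t\<in>S. (cnj (x s) * K s t * x t) * L s t)"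
    by (intro Schur_sum_nonneg psd_kernel_scale S psd_kernel_subset[OF assms(1) S(2)]
        psd_kernel_subset[OF assms(2) S(2)])
  then show "0 \<le> (\<Sum>s\<in>S. \<Sum>t\<in>S. cnj (x s) * (K s t * L s t) * x t)"
    by (simp add: mult_ac)
qed

lemma psd_kernel_const: "0 \<le> c \<Longrightarrow> psd_kernel X (\<lambda>_ _. c)"
  unfolding psd_kernel_def
proof (intro allI impI)
  fix S and x :: "'a \<Rightarrow> complex" assume c: "0 \<le> c"
  have "(\<Sum>s\<in>S. \<Sum>t\<in>S. cnj (x s) * c * x t) = c * ((\<Sum>s\<in>S. x s) * cnj (\<Sum>s\<in>S. x s))"
    by (simp add: sum_product sum_distrib_left mult_ac)
  also have "\<dots> = c * complex_of_real ((cmod (\<Sum>s\<in>S. x s))\<^sup>2)"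
    by (simp only: complex_norm_square)
  also have "0 \<le> \<dots>" using c by (intro mult_nonneg_nonneg) (auto simp: less_eq_complex_def)
  finally show "0 \<le> (\<Sum>s\<in>S. \<Sum>t\<in>S. cnj (x s) * c * x t)" .
qed

lemma psd_kernel_add:
  assumes "psd_kernel X K" "psd_kernel X L"
  shows "psd_kernel X (\<lambda>s t. K s t + L s t)"
  unfolding psd_kernel_def
proof (intro allI impI, elim conjE)
  fix S x assume S: "finite S" "S \<subseteq> X"
  show "0 \<le> (\<Sum>s\<in>S. \<Sum>t\<in>S. cnj (x s) * (K s t + L s t) * x t)"
    using add_nonneg_nonneg[OF psd_kernelD[OF assms(1) S, of x] psd_kernelD[OF assms(2) S, of x]]
    by (simp add: sum.distrib distrib_left distrib_right)
qed

lemma complex_nonneg_limit: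
  fixes f :: "nat \<Rightarrow> complex"
  assumes "f \<longlonglongrightarrow> l" "\<And>n. 0 \<le> f n"
  shows "0 \<le> l"
  using assms LIMSEQ_le_const[OF tendsto_Re[OF assms(1)], of 0]
    LIMSEQ_unique[OF tendsto_Im[OF assms(1)], of 0]
  by (simp add: less_eq_complex_def)

lemma psd_kernel_limit:
  assumes "\<And>n :: nat. psd_kernel X (K n)"
    and "\<And>s t. s \<in> X \<Longrightarrow> t \<in> X \<Longrightarrow> (\<lambda>n. K n s t) \<longlonglongrightarrow> L s t"
  shows "psd_kernel X L"
  unfolding psd_kernel_def
proof (intro allI impI, elim conjE)
  fix S x assume S: "finite S" "S \<subseteq> X"
  show "0 \<le> (\<Sum>s\<in>S. \<Sum>t\<in>S. cnj (x s) * L s t * x t)"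
  proof (rule complex_nonneg_limit)
    show "(\<lambda>n. \<Sum>s\<in>S. \<Sum>t\<in>S. cnj (x s) * K n s t * x t)
        \<longlonglongrightarrow> (\<Sum>s\<in>S. \<Sum>t\<in>S. cnj (x s) * L s t * x t)"
      using S by (intro tendsto_intros assms(2)) auto
    show "0 \<le> (\<Sum>s\<in>S. \<Sum>t\<in>S. cnj (x s) * K n s t * x t)" for n
      by (rule psd_kernelD[OF assms(1) S])
  qed
qed

text \<open>The exponential series has nonnegative coefficients, its powers are Schur products, and
  positivity survives the pointwise limit of the partial sums.\<close>

lemma psd_kernel_exp:
  assumes "psd_kernel X K"
  shows "psd_kernel X (\<lambda>s t. exp (K s t))"
proof (rule psd_kernel_limit)
  have pow: "psd_kernel X (\<lambda>s t. K s t ^ k)" for k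
    by (induction k) (simp_all add: psd_kernel_const psd_kernel_mult assms less_eq_complex_def)
  have "psd_kernel X (\<lambda>s t. complex_of_real (inverse (fact k)) * K s t ^ k)" for k
    by (intro psd_kernel_mult pow psd_kernel_const) (simp add: less_eq_complex_def)
  then show "psd_kernel X (\<lambda>s t. \<Sum>k<n. complex_of_real (inverse (fact k)) * K s t ^ k)" for n
    by (induction n) (simp_all add: psd_kernel_const psd_kernel_add less_eq_complex_def)
  show "(\<lambda>n. \<Sum>k<n. complex_of_real (inverse (fact k)) * K s t ^ k) \<longlonglongrightarrow> exp (K s t)" for s t
    using exp_converges[of "K s t"] by (simp add: sums_def scaleR_conv_of_real)
qed

text \<open>The form of \<open>L\<close> at \<open>x\<close> is the form of \<open>K\<close> at the
  weights \<open>y t\<close>, the sum of \<open>x s * a s t\<close> over \<open>s\<close>. This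
  covers pullbacks, rescalings and linear expansions of the index points alike.\<close>

lemma psd_kernel_combination:
  fixes K :: "'i \<Rightarrow> 'i \<Rightarrow> complex" and L :: "'j \<Rightarrow> 'j \<Rightarrow> complex"
  assumes K: "psd_kernel X K"
    and T: "\<And>s. s \<in> Y \<Longrightarrow> finite (T s)" "\<And>s. s \<in> Y \<Longrightarrow> T s \<subseteq> X"
    and L: "\<And>s s'. s \<in> Y \<Longrightarrow> s' \<in> Y \<Longrightarrow>
      L s s' = (\<Sum>t\<in>T s. \<Sum>t'\<in>T s'. cnj (a s t) * K t t' * a s' t')"
  shows "psd_kernel Y L"
  unfolding psd_kernel_def
proof (intro allI impI, elim conjE)
  fix S x assume S: "finite S" "S \<subseteq> Y"
  define U where "U = (\<Union>s\<in>S. T s)"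
  have U: "finite U" "U \<subseteq> X" using S T by (auto simp: U_def)
  \<comment> \<open>Extension by 0 lets all expansions run over the common finite set
    \<open>U\<close>, so that the order of summation can be changed.\<close>
  define a' where "a' s t = (if t \<in> T s then a s t else 0)" for s t
  define y where "y t = (\<Sum>s\<in>S. x s * a' s t)" for t
  have L': "L s s' = (\<Sum>t\<in>U. \<Sum>t'\<in>U. cnj (a' s t) * K t t' * a' s' t')" if "s \<in> S" "s' \<in> S" for s s'
  proof -
    have sub: "T s \<subseteq> U" "T s' \<subseteq> U" using that by (auto simp: U_def)
    have "L s s' = (\<Sum>t\<in>T s. \<Sum>t'\<in>T s'. cnj (a' s t) * K t t' * a' s' t')"
      using that S by (subst L) (auto simp: a'_def intro!: sum.cong)
    also have "\<dots> = (\<Sum>t\<in>T s. \<Sum>t'\<in>U. cnj (a' s t) * K t t' * a' s' t')"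
      using U sub by (intro sum.cong refl sum.mono_neutral_left) (auto simp: a'_def)
    also have "\<dots> = (\<Sum>t\<in>U. \<Sum>t'\<in>U. cnj (a' s t) * K t t' * a' s' t')"
      using U sub by (intro sum.mono_neutral_left) (auto simp: a'_def)
    finally show ?thesis .
  qed
  have "0 \<le> (\<Sum>t\<in>U. \<Sum>t'\<in>U. cnj (y t) * K t t' * y t')"
    by (rule psd_kernelD[OF K U])
  also have "\<dots> = (\<Sum>t\<in>U. \<Sum>t'\<in>U. \<Sum>s\<in>S. \<Sum>s'\<in>S. cnj (x s) * (cnj (a' s t) * K t t' * a' s' t') * x s')"
  proof (intro sum.cong refl)
    fix t t'
    have "cnj (y t) * K t t' * y t'
        = (\<Sum>s\<in>S. cnj (x s) * cnj (a' s t) * K t t') * (\<Sum>s'\<in>S. x s' * a' s' t')"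
      by (simp add: y_def sum_distrib_right[symmetric])
    also have "\<dots> = (\<Sum>s\<in>S. \<Sum>s'\<in>S. cnj (x s) * (cnj (a' s t) * K t t' * a' s' t') * x s')"
      unfolding sum_product by (intro sum.cong refl) (simp add: mult_ac)
    finally show "cnj (y t) * K t t' * y t'
        = (\<Sum>s\<in>S. \<Sum>s'\<in>S. cnj (x s) * (cnj (a' s t) * K t t' * a' s' t') * x s')" .
  qed
  also have "\<dots> = (\<Sum>t\<in>U. \<Sum>s\<in>S. \<Sum>t'\<in>U. \<Sum>s'\<in>S. cnj (x s) * (cnj (a' s t) * K t t' * a' s' t') * x s')"
    by (rule sum.cong[OF refl], rule sum.swap)
  also have "\<dots> = (\<Sum>s\<in>S. \<Sum>t\<in>U. \<Sum>t'\<in>U. \<Sum>s'\<in>S. cnj (x s) * (cnj (a' s t) * K t t' * a' s' t') * x s')"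
    by (rule sum.swap)
  also have "\<dots> = (\<Sum>s\<in>S. \<Sum>t\<in>U. \<Sum>s'\<in>S. \<Sum>t'\<in>U. cnj (x s) * (cnj (a' s t) * K t t' * a' s' t') * x s')"
    by (rule sum.cong[OF refl], rule sum.cong[OF refl], rule sum.swap)
  also have "\<dots> = (\<Sum>s\<in>S. \<Sum>s'\<in>S. \<Sum>t\<in>U. \<Sum>t'\<in>U. cnj (x s) * (cnj (a' s t) * K t t' * a' s' t') * x s')"
    by (rule sum.cong[OF refl], rule sum.swap)
  also have "\<dots> = (\<Sum>s\<in>S. \<Sum>s'\<in>S. cnj (x s) * L s s' * x s')"
    by (intro sum.cong refl) (simp only: L' sum_distrib_left sum_distrib_right)
  finally show "0 \<le> (\<Sum>s\<in>S. \<Sum>s'\<in>S. cnj (x s) * L s s' * x s')" .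
qed

text \<open>Points with a common image under \<open>f\<close> are allowed: their weights add
  up.\<close>

lemma psd_kernel_comp:
  assumes "psd_kernel X K" "f ` Y \<subseteq> X"
  shows "psd_kernel Y (\<lambda>s t. K (f s) (f t))"
  by (rule psd_kernel_combination[OF assms(1), where T = "\<lambda>s. {f s}" and a = "\<lambda>_ _. 1"])
    (use assms(2) in auto)

subsection \<open>The Fock space\<close>

lemma fock_eqI: "(\<And>n. fock_coeff \<phi> n = fock_coeff \<psi> n) \<Longrightarrow> \<phi> = \<psi>"
  by (simp add: fock_coeff_inject[symmetric] fun_eq_iff)

lemmas fock_coeff_simps [simp] =
  cscale.rep_eq plus_fock.rep_eq minus_fock.rep_eq uminus_fock.rep_eq zero_fock.rep_eq
  scaleR_fock.rep_eq

lemma fock_coeff_sum: "fock_coeff (\<Sum>i\<in>I. f i) n = (\<Sum>i\<in>I. fock_coeff (f i) n)"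
  by (induction I rule: infinite_finite_induct) auto

lemma cscale_add_right: "cscale c (\<phi> + \<psi>) = cscale c \<phi> + cscale c \<psi>"
  and cscale_add_left: "cscale (c + d) \<phi> = cscale c \<phi> + cscale d \<phi>"
  and cscale_diff_right: "cscale c (\<phi> - \<psi>) = cscale c \<phi> - cscale c \<psi>"
  and cscale_cscale: "cscale c (cscale d \<phi>) = cscale (c * d) \<phi>"
  and cscale_zero_left: "cscale 0 \<phi> = 0"
  and cscale_zero_right: "cscale c 0 = 0"
  and scaleR_cscale: "r *\<^sub>R \<phi> = cscale (complex_of_real r) \<phi>"
  by (rule fock_eqI; simp add: algebra_simps)+

lemma cinner_summable:
  "(\<lambda>n. cnj (fock_coeff \<phi> n) * fock_coeff \<psi> n) summable_on UNIV"
  using fock_coeff[of \<phi>] fock_coeff[of \<psi>] by (intro square_summable_product) auto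

lemma cinner_cnj: "cinner \<psi> \<phi> = cnj (cinner \<phi> \<psi>)"
  by (simp add: cinner.rep_eq infsum_cnj[symmetric] mult.commute)

lemma cinner_add_right: "cinner \<phi> (\<psi> + \<xi>) = cinner \<phi> \<psi> + cinner \<phi> \<xi>"
  by (simp add: cinner.rep_eq distrib_left infsum_add cinner_summable)

lemma cinner_cscale_right: "cinner \<phi> (cscale c \<psi>) = c * cinner \<phi> \<psi>"
  unfolding cinner.rep_eq by (simp add: mult.left_commute[of _ c] infsum_cmult_right')

lemma cinner_add_left: "cinner (\<phi> + \<psi>) \<xi> = cinner \<phi> \<xi> + cinner \<psi> \<xi>"
  by (metis cinner_add_right cinner_cnj complex_cnj_add)

lemma cinner_cscale_left: "cinner (cscale c \<phi>) \<psi> = cnj c * cinner \<phi> \<psi>"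
  by (metis cinner_cscale_right cinner_cnj complex_cnj_mult)

lemma cinner_zero [simp]: "cinner 0 \<psi> = 0" "cinner \<phi> 0 = 0"
  by (simp_all add: cinner.rep_eq)

lemma cinner_diff_right: "cinner \<phi> (\<psi> - \<xi>) = cinner \<phi> \<psi> - cinner \<phi> \<xi>"
  by (metis add_diff_cancel cinner_add_right diff_add_cancel)

lemma cinner_diff_left: "cinner (\<phi> - \<psi>) \<xi> = cinner \<phi> \<xi> - cinner \<psi> \<xi>"
  by (metis cinner_cnj cinner_diff_right complex_cnj_diff)

lemma cinner_sum_right: "cinner \<phi> (\<Sum>i\<in>I. f i) = (\<Sum>i\<in>I. cinner \<phi> (f i))"
  by (induction I rule: infinite_finite_induct) (auto simp: cinner_add_right)

lemma cinner_sum_left: "cinner (\<Sum>i\<in>I. f i) \<psi> = (\<Sum>i\<in>I. cinner (f i) \<psi>)"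
  by (induction I rule: infinite_finite_induct) (auto simp: cinner_add_left)

lemma norm_fock_square: "(norm \<psi>)\<^sup>2 = (\<Sum>\<^sub>\<infinity>n. (cmod (fock_coeff \<psi> n))\<^sup>2)"
proof -
  have "((\<lambda>n. complex_of_real ((cmod (fock_coeff \<psi> n))\<^sup>2)) has_sum
      complex_of_real (\<Sum>\<^sub>\<infinity>n. (cmod (fock_coeff \<psi> n))\<^sup>2)) UNIV"
    using fock_coeff[of \<psi>] by (intro has_sum_of_real has_sum_infsum) auto
  moreover have "cinner \<psi> \<psi> = (\<Sum>\<^sub>\<infinity>n. complex_of_real ((cmod (fock_coeff \<psi> n))\<^sup>2))"
    unfolding cinner.rep_eq by (intro infsum_cong) (metis complex_norm_square mult.commute of_real_power)
  ultimately have "cinner \<psi> \<psi> = complex_of_real (\<Sum>\<^sub>\<infinity>n. (cmod (fock_coeff \<psi> n))\<^sup>2)"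
    by (simp add: infsumI)
  then show ?thesis
    by (simp add: power2_norm_eq_inner inner_fock_def)
qed

lemma norm_cscale: "norm (cscale c \<psi>) = cmod c * norm \<psi>"
proof -
  have "(norm (cscale c \<psi>))\<^sup>2 = (cmod c * norm \<psi>)\<^sup>2"
    by (simp add: norm_fock_square power_mult_distrib norm_mult infsum_cmult_right')
  then show ?thesis by simp
qed

lemma cmod_cinner_le: "cmod (cinner \<phi> \<psi>) \<le> norm \<phi> * norm \<psi>"
proof (cases "cinner \<phi> \<psi> = 0")
  case False
  \<comment> \<open>A phase that rotates \<open>cinner \<phi> \<psi>\<close> onto the nonnegative
    real axis, where it equals the real inner product and the real Cauchy-Schwarz inequality
    applies.\<close>
  define u where "u = cnj (cinner \<phi> \<psi>) / cmod (cinner \<phi> \<psi>)"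
  have "u * cinner \<phi> \<psi> = cmod (cinner \<phi> \<psi>)"
    using False complex_norm_square[of "cinner \<phi> \<psi>"]
    by (simp add: u_def field_simps power2_eq_square)
  then have "cmod (cinner \<phi> \<psi>) = \<phi> \<bullet> cscale u \<psi>"
    by (simp add: inner_fock_def cinner_cscale_right)
  also have "\<dots> \<le> norm \<phi> * norm (cscale u \<psi>)"
    by (rule norm_cauchy_schwarz)
  also have "norm (cscale u \<psi>) = norm \<psi>"
    using False by (simp add: norm_cscale u_def norm_divide)
  finally show ?thesis .
qed simp

text \<open>Bilinearity is meant over the reals, so the antilinear first slot fits.\<close>

lemma bounded_bilinear_cinner: "bounded_bilinear (cinner :: 'm::finite fock \<Rightarrow> _)"
proof
  show "\<exists>K. \<forall>a b :: 'm fock. norm (cinner a b) \<le> norm a * norm b * K"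
    by (rule exI[of _ 1]) (simp add: cmod_cinner_le)
qed (simp_all add: cinner_add_left cinner_add_right scaleR_cscale cinner_cscale_left
    cinner_cscale_right scaleR_conv_of_real)

lemma bounded_linear_cscale: "bounded_linear (cscale c :: 'm::finite fock \<Rightarrow> _)"
  by (rule bounded_linear_intro[where K = "cmod c"])
    (simp_all add: cscale_add_right scaleR_cscale cscale_cscale norm_cscale mult.commute)

subsection \<open>Truncation to finitely many Fock states\<close>

text \<open>The boxes are a sequence cofinal among the finite sets of occupation numbers, so
  unconditional sums become limits of sequences.\<close>

definition fock_box :: "nat \<Rightarrow> (nat ^ 'm::finite) set"
  where "fock_box N = {n. \<forall>i. n $ i < N}"

lemma finite_fock_box: "finite (fock_box N :: (nat ^ 'm::finite) set)"
proof -
  have "fock_box N \<subseteq> vec_lambda ` (PiE UNIV (\<lambda>_ :: 'm. {..<N}))"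
  proof
    fix n :: "nat ^ 'm" assume "n \<in> fock_box N"
    then show "n \<in> vec_lambda ` (PiE UNIV (\<lambda>_. {..<N}))"
      by (intro image_eqI[of _ _ "vec_nth n"]) (auto simp: fock_box_def)
  qed
  then show ?thesis by (rule finite_subset) (intro finite_imageI finite_PiE; simp)
qed

lemma filterlim_fock_box: "filterlim fock_box (finite_subsets_at_top UNIV) sequentially"
  unfolding filterlim_finite_subsets_at_top
proof (intro allI impI)
  fix X :: "(nat ^ 'm) set" assume X: "finite X \<and> X \<subseteq> UNIV"
  \<comment> \<open>\<open>M\<close> bounds every occupation number in \<open>X\<close>; the
    inserted 0 keeps the maximum defined when \<open>X\<close> is empty.\<close>
  define M where "M = Max (insert 0 ((\<lambda>(n, i). n $ i) ` (X \<times> UNIV)))"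
  have M: "n $ i \<le> M" if "n \<in> X" for n i
    unfolding M_def using X that by (intro Max_ge) force+
  show "eventually (\<lambda>N. finite (fock_box N :: (nat ^ 'm) set) \<and> X \<subseteq> fock_box N \<and> fock_box N \<subseteq> UNIV)
      sequentially"
    using eventually_gt_at_top[of M]
  proof eventually_elim
    case (elim N)
    then show ?case by (intro conjI finite_fock_box) (auto simp: fock_box_def intro: le_less_trans[OF M])
  qed
qed

lemma infsum_outside_box_tendsto_0:
  fixes g :: "nat ^ 'm::finite \<Rightarrow> real"
  assumes "g summable_on UNIV"
  shows "(\<lambda>N. infsum g (- fock_box N)) \<longlonglongrightarrow> 0"
proof -
  have "(\<lambda>N. sum g (fock_box N)) \<longlonglongrightarrow> infsum g UNIV"
    using has_sum_infsum[OF assms] filterlim_compose filterlim_fock_box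
    unfolding has_sum_def by blast
  then have "(\<lambda>N. infsum g UNIV - sum g (fock_box N)) \<longlonglongrightarrow> infsum g UNIV - infsum g UNIV"
    by (intro tendsto_intros)
  moreover have "infsum g (- fock_box N) = infsum g UNIV - sum g (fock_box N)" for N
    using infsum_Diff[OF assms summable_on_finite[OF finite_fock_box], of N]
    by (simp add: Compl_eq_Diff_UNIV finite_fock_box)
  ultimately show ?thesis by simp
qed

text \<open>The common tail estimate for the truncation error and for the error of the torus
  average: both are vectors that vanish on a box and are dominated off it by a fixed summable
  function.\<close>

lemma norm_fock_le_outside:
  assumes g: "g summable_on UNIV"
    and le: "\<And>n. (cmod (fock_coeff \<psi> n))\<^sup>2 \<le> (if n \<in> B then 0 else g n)"
  shows "norm \<psi> \<le> sqrt (infsum g (- B))"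
proof (rule real_le_rsqrt)
  have gB: "g summable_on (- B)" by (rule summable_on_subset_banach[OF g]) simp
  have "(norm \<psi>)\<^sup>2 \<le> (\<Sum>\<^sub>\<infinity>n\<in>- B. g n)"
    unfolding norm_fock_square
  proof (rule infsum_mono_neutral)
    show "(\<lambda>n. (cmod (fock_coeff \<psi> n))\<^sup>2) summable_on UNIV" using fock_coeff[of \<psi>] by simp
    show "(cmod (fock_coeff \<psi> n))\<^sup>2 \<le> g n" if "n \<in> UNIV \<inter> - B" for n using le[of n] that by auto
    show "(cmod (fock_coeff \<psi> n))\<^sup>2 \<le> 0" if "n \<in> UNIV - - B" for n using le[of n] that by auto
  qed (use gB in auto)
  then show "(norm \<psi>)\<^sup>2 \<le> infsum g (- B)" .
qed

lift_definition fock_trunc :: "(nat ^ 'm) set \<Rightarrow> 'm::finite fock \<Rightarrow> 'm fock"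
  is "\<lambda>B \<psi> n. if n \<in> B then \<psi> n else 0"
  by (erule summable_on_comparison_test) auto

lift_definition fock_state :: "nat ^ 'm \<Rightarrow> 'm::finite fock" is "\<lambda>p n. if n = p then 1 else 0"
proof -
  fix p :: "nat ^ 'm"
  have "(\<lambda>n. if n = p then 1 else 0 :: real) summable_on {p}" by simp
  then show "(\<lambda>n. (cmod (if n = p then 1 else 0))\<^sup>2) summable_on UNIV"
    by (rule summable_on_cong_neutral[THEN iffD1, rotated -1]) auto
qed

lemma fock_trunc_eq_sum:
  assumes "finite B"
  shows "fock_trunc B \<psi> = (\<Sum>p\<in>B. cscale (fock_coeff \<psi> p) (fock_state p))"
proof (rule fock_eqI)
  fix n
  have "(\<Sum>p\<in>B. fock_coeff \<psi> p * (if n = p then 1 else 0))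
      = (\<Sum>p\<in>B. if n = p then fock_coeff \<psi> p else 0)"
    by (intro sum.cong) auto
  also have "\<dots> = (if n \<in> B then fock_coeff \<psi> n else 0)"
    using assms by simp
  finally have "(\<Sum>p\<in>B. fock_coeff \<psi> p * (if n = p then 1 else 0))
      = (if n \<in> B then fock_coeff \<psi> n else 0)" .
  then show "fock_coeff (fock_trunc B \<psi>) n
      = fock_coeff (\<Sum>p\<in>B. cscale (fock_coeff \<psi> p) (fock_state p)) n"
    by (simp add: fock_coeff_sum fock_trunc.rep_eq fock_state.rep_eq)
qed

lemma fock_trunc_tendsto: "(\<lambda>N. fock_trunc (fock_box N) \<psi>) \<longlonglongrightarrow> \<psi>"
proof (rule LIM_zero_cancel, rule Lim_null_comparison)
  define g where "g n = (cmod (fock_coeff \<psi> n))\<^sup>2" for n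
  have g: "g summable_on UNIV" using fock_coeff[of \<psi>] by (simp add: g_def[abs_def])
  show "\<forall>\<^sub>F N in sequentially. norm (fock_trunc (fock_box N) \<psi> - \<psi>)
      \<le> sqrt (infsum g (- fock_box N))"
    by (intro always_eventually allI norm_fock_le_outside g) (simp add: g_def fock_trunc.rep_eq)
  show "(\<lambda>N. sqrt (infsum g (- fock_box N))) \<longlonglongrightarrow> 0"
    using tendsto_real_sqrt[OF infsum_outside_box_tendsto_0[OF g]] by simp
qed

lemma norm_fock_trunc_le: "norm (fock_trunc B \<psi>) \<le> norm \<psi>"
proof (rule power2_le_imp_le)
  show "(norm (fock_trunc B \<psi>))\<^sup>2 \<le> (norm \<psi>)\<^sup>2"
    using fock_coeff[of \<psi>] fock_coeff[of "fock_trunc B \<psi>"] unfolding norm_fock_square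
    by (intro infsum_mono) (auto simp: fock_trunc.rep_eq)
qed simp

lemma bounded_linear_fock_trunc: "bounded_linear (fock_trunc B)"
proof (rule bounded_linear_intro[where K = 1])
  show "fock_trunc B (\<phi> + \<psi>) = fock_trunc B \<phi> + fock_trunc B \<psi>" for \<phi> \<psi>
    by (rule fock_eqI) (simp add: fock_trunc.rep_eq)
  show "fock_trunc B (r *\<^sub>R \<psi>) = r *\<^sub>R fock_trunc B \<psi>" for r \<psi>
    by (rule fock_eqI) (simp add: fock_trunc.rep_eq)
qed (simp add: norm_fock_trunc_le)

lemma fock_trunc_cscale: "fock_trunc B (cscale c \<psi>) = cscale c (fock_trunc B \<psi>)"
  by (rule fock_eqI) (simp add: fock_trunc.rep_eq)

lemma cinner_fock_trunc: "cinner (fock_trunc B \<phi>) \<psi> = cinner \<phi> (fock_trunc B \<psi>)"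
  unfolding cinner.rep_eq by (intro infsum_cong) (simp add: fock_trunc.rep_eq)

lemma cinner_fock_state: "cinner (fock_state p) \<psi> = fock_coeff \<psi> p"
proof -
  have "cinner (fock_state p) \<psi> = (\<Sum>\<^sub>\<infinity>n\<in>{p}. cnj (fock_coeff (fock_state p) n) * fock_coeff \<psi> n)"
    unfolding cinner.rep_eq by (intro infsum_cong_neutral) (auto simp: fock_state.rep_eq)
  then show ?thesis by (simp add: fock_state.rep_eq)
qed

subsection \<open>Density of the span of the coherent states\<close>

text \<open>\<open>span\<close> is the real span; with all complex multiples as generators it
  becomes the complex span of the coherent states.\<close>

definition coherent_multiples :: "'m::finite fock set"
  where "coherent_multiples = {cscale c (coherent z) | c z. True}"

text \<open>Orthogonality of the characters of the cyclic group of order \<open>N\<close>: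
  \<open>D p n\<close> is the mean of \<open>\<omega>\<close> to the power
  \<open>k * (n - p)\<close>. An \<open>n\<close> beyond \<open>N\<close> may be congruent to
  \<open>p\<close>, so only the bound 1 is recorded there.\<close>

lemma roots_of_unity_average:
  assumes N: "N > 0"
  defines "\<omega> \<equiv> (exp (2 * of_real pi * \<i> / of_nat N) :: complex)"
  defines "D \<equiv> \<lambda>p n :: nat. (\<Sum>k<N. cnj (\<omega> ^ (p * k)) * (\<omega> ^ k) ^ n / of_nat N)"
  shows "cmod (D p n) \<le> 1" and "D p p = 1"
    and "p < N \<Longrightarrow> n < N \<Longrightarrow> p \<noteq> n \<Longrightarrow> D p n = 0"
proof -
  have norm_\<omega>: "cmod \<omega> = 1" by (simp add: \<omega>_def norm_exp_eq_Re)
  have unit: "cnj (\<omega> ^ j) * \<omega> ^ j = 1" for j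
    using complex_norm_square[of "\<omega> ^ j"] by (simp add: norm_\<omega> norm_power mult.commute)
  have "cmod (D p n) \<le> (\<Sum>k<N. 1 / real N)"
    unfolding D_def
    by (rule order_trans[OF norm_sum]) (simp add: norm_mult norm_divide norm_power norm_\<omega>)
  then show "cmod (D p n) \<le> 1" using N by simp
  show "D p p = 1"
    using N unit unfolding D_def by (simp add: power_mult[symmetric] mult.commute[of _ p])
  assume pn: "p < N" "n < N" "p \<noteq> n"
  have \<omega>_pow: "\<omega> ^ j = exp (2 * of_real pi * \<i> * of_nat j / of_nat N)" for j
    by (simp add: \<omega>_def exp_of_nat_mult[symmetric] field_simps)
  \<comment> \<open>This is \<open>\<omega>\<close> to the power \<open>n - p\<close>, written with
    a conjugate because the exponent may be negative. It is an \<open>N\<close>-th root of unity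
    other than 1, so its geometric sum vanishes.\<close>
  define q where "q = cnj (\<omega> ^ p) * \<omega> ^ n"
  have "\<omega> ^ n \<noteq> \<omega> ^ p"
    using complex_root_unity_eq[of N n p] pn by (simp add: \<omega>_pow)
  moreover have "\<omega> ^ p * q = \<omega> ^ n"
    using unit[of p] by (simp add: q_def mult.assoc[symmetric] mult.commute[of "\<omega> ^ p"])
  ultimately have q: "q \<noteq> 1" by auto
  have "\<omega> ^ N = 1" using N by (simp add: \<omega>_pow exp_two_pi_i')
  moreover from this have "cnj \<omega> ^ N = 1" by (metis complex_cnj_one complex_cnj_power)
  ultimately have "q ^ N = 1"
    by (simp add: q_def power_mult_distrib power_mult[symmetric] mult.commute[of _ N])
       (simp add: power_mult)
  then have "(\<Sum>k<N. q ^ k) = 0" using geometric_sum[OF q, of N] by simp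
  moreover have "D p n = (\<Sum>k<N. q ^ k) / of_nat N"
    unfolding D_def sum_divide_distrib
    by (simp add: q_def power_mult_distrib power_mult[symmetric] mult.commute)
  ultimately show "D p n = 0" by simp
qed

text \<open>Averaging coherent states over a torus of roots of unity isolates a Fock state, up to states
  with some occupation number at least \<open>N\<close>.\<close>

lemma fock_state_approx:
  fixes p :: "nat ^ 'm::finite"
  assumes p: "p \<in> fock_box N"
  defines "g \<equiv> \<lambda>n :: nat ^ 'm. (cmod ((\<Prod>i\<in>UNIV. 1 / complex_of_real (sqrt (fact (n $ i))))))\<^sup>2"
  defines "C \<equiv> \<lambda>p :: nat ^ 'm. (\<Prod>i\<in>UNIV. sqrt (fact (p $ i)))"
  shows "\<exists>v \<in> span coherent_multiples. norm (v - cscale a (fock_state p))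
    \<le> sqrt ((cmod a * C p)\<^sup>2 * infsum g (- fock_box N))"
proof -
  have N: "N > 0" using p by (auto simp: fock_box_def)
  define \<omega> where "\<omega> = (exp (2 * of_real pi * \<i> / of_nat N) :: complex)"
  define D where "D p n = (\<Sum>k<N. cnj (\<omega> ^ (p * k)) * (\<omega> ^ k) ^ n / of_nat N)" for p n :: nat
  note D = roots_of_unity_average[OF N, folded \<omega>_def, folded D_def]
  \<comment> \<open>The coherent state without its Gaussian normalization: the coefficients are
    monomials in \<open>z\<close> over square roots of factorials.\<close>
  define E where "E z = cscale (complex_of_real (exp ((norm z)\<^sup>2 / 2))) (coherent z)" for z :: "complex ^ 'm"
  have E: "fock_coeff (E z) n = (\<Prod>i\<in>UNIV. z $ i ^ (n $ i) / complex_of_real (sqrt (fact (n $ i))))" for z n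
    by (simp add: E_def coherent.rep_eq mult.assoc[symmetric] exp_minus of_real_mult[symmetric]
        del: of_real_mult)
  \<comment> \<open>The sum over the grid of roots of unity factorizes into one average
    \<open>D\<close> per mode, and \<open>C p\<close> cancels the factorials at the occupation
    numbers \<open>p\<close>.\<close>
  define v where "v = (\<Sum>k\<in>PiE UNIV (\<lambda>_ :: 'm. {..<N}).
    cscale (a * C p * (\<Prod>i\<in>UNIV. cnj (\<omega> ^ (p $ i * k i)) / of_nat N)) (E (\<chi> i. \<omega> ^ k i)))"
  have coeff: "fock_coeff v n = a * C p * (\<Prod>i\<in>UNIV. D (p $ i) (n $ i) / complex_of_real (sqrt (fact (n $ i))))" for n
  proof -
    have "fock_coeff v n = a * C p * (\<Sum>k\<in>PiE UNIV (\<lambda>_ :: 'm. {..<N}). \<Prod>i\<in>UNIV.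
        cnj (\<omega> ^ (p $ i * k i)) * (\<omega> ^ k i) ^ (n $ i) / of_nat N / complex_of_real (sqrt (fact (n $ i))))"
      unfolding v_def fock_coeff_sum sum_distrib_left
      by (intro sum.cong refl) (simp add: E prod.distrib[symmetric] mult.assoc)
    also have "(\<Sum>k\<in>PiE UNIV (\<lambda>_ :: 'm. {..<N}). \<Prod>i\<in>UNIV.
        cnj (\<omega> ^ (p $ i * k i)) * (\<omega> ^ k i) ^ (n $ i) / of_nat N / complex_of_real (sqrt (fact (n $ i))))
      = (\<Prod>i\<in>UNIV. \<Sum>k<N. cnj (\<omega> ^ (p $ i * k)) * (\<omega> ^ k) ^ (n $ i) / of_nat N / complex_of_real (sqrt (fact (n $ i))))"
      by (rule prod_sum_PiE[symmetric]) auto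
    finally show ?thesis by (simp add: D_def sum_divide_distrib)
  qed
  have "v \<in> span coherent_multiples"
    unfolding v_def
    by (intro span_sum span_base) (auto simp: coherent_multiples_def E_def cscale_cscale)
  moreover have "norm (v - cscale a (fock_state p)) \<le> sqrt (infsum (\<lambda>n. (cmod a * C p)\<^sup>2 * g n) (- fock_box N))"
  proof (rule norm_fock_le_outside)
    show "(\<lambda>n. (cmod a * C p)\<^sup>2 * g n) summable_on UNIV"
      using coherent_square_summable[of 1 "1 :: complex ^ 'm"]
      by (intro summable_on_cmult_right) (simp add: g_def)
    fix n :: "nat ^ 'm"
    show "(cmod (fock_coeff (v - cscale a (fock_state p)) n))\<^sup>2
        \<le> (if n \<in> fock_box N then 0 else (cmod a * C p)\<^sup>2 * g n)"
    proof (cases "n \<in> fock_box N")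
      case True
      have "fock_coeff v n = a * (if n = p then 1 else 0)"
      proof (cases "n = p")
        case True
        then show ?thesis
          by (simp add: coeff D(2) C_def prod_dividef)
      next
        case False
        then obtain i where "n $ i \<noteq> p $ i" by (auto simp: vec_eq_iff)
        then have "D (p $ i) (n $ i) = 0"
          using True p by (intro D(3)) (auto simp: fock_box_def)
        then show ?thesis using False by (auto simp: coeff intro!: prod_zero)
      qed
      then show ?thesis using True by (simp add: fock_state.rep_eq)
    next
      \<comment> \<open>Off the box aliasing is possible, but every factor \<open>D\<close> has
        modulus at most 1, which leaves the coefficients dominated by those of
        \<open>g\<close>.\<close>
      case False
      then have "n \<noteq> p" using p by auto
      then have "cmod (fock_coeff (v - cscale a (fock_state p)) n)
          = cmod a * C p * (\<Prod>i\<in>UNIV. cmod (D (p $ i) (n $ i)) * (1 / sqrt (fact (n $ i))))"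
        by (simp add: fock_state.rep_eq coeff norm_mult prod_norm[symmetric] norm_divide C_def
            prod_nonneg abs_prod)
      also have "\<dots> \<le> cmod a * C p * (\<Prod>i\<in>UNIV. 1 * (1 / sqrt (fact (n $ i))))"
        using D(1) by (intro mult_left_mono prod_mono conjI mult_right_mono)
          (auto simp: C_def prod_nonneg)
      also have "(\<Prod>i\<in>UNIV. 1 * (1 / sqrt (fact (n $ i))))
          = cmod (\<Prod>i\<in>UNIV. 1 / complex_of_real (sqrt (fact (n $ i))))"
        by (simp add: prod_norm[symmetric] norm_divide)
      finally show ?thesis
        using False by (simp add: g_def power_mult_distrib[symmetric] power_mono)
    qed
  qed
  ultimately show ?thesis by (auto simp: infsum_cmult_right')
qed

text \<open>In the error bound the factor \<open>K\<close> depends only on \<open>a\<close> and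
  \<open>p\<close>, while the tail of a fixed summable series tends to 0 as \<open>N\<close>
  grows.\<close>

lemma fock_state_in_closure: "cscale a (fock_state p) \<in> closure (span coherent_multiples)"
proof -
  define g where "g n = (cmod ((\<Prod>i\<in>UNIV. 1 / complex_of_real (sqrt (fact (n $ i))))))\<^sup>2" for n :: "nat ^ 'a"
  define K where "K = (cmod a * (\<Prod>i\<in>UNIV. sqrt (fact (p $ i))))\<^sup>2"
  have g: "g summable_on UNIV"
    using coherent_square_summable[of 1 "1 :: complex ^ 'a"] by (simp add: g_def[abs_def])
  have lim: "(\<lambda>N. sqrt (K * infsum g (- fock_box N))) \<longlonglongrightarrow> 0"
    using tendsto_real_sqrt[OF tendsto_mult_right_zero[OF infsum_outside_box_tendsto_0[OF g]]] by simp
  have ev: "eventually (\<lambda>N. p \<in> fock_box N) sequentially"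
    by (rule eventually_mono[OF filterlim_fock_box[unfolded filterlim_finite_subsets_at_top,
            rule_format, of "{p}"]]) auto
  show ?thesis
    unfolding closure_approachable
  proof (intro allI impI)
    fix e :: real assume "e > 0"
    then have "eventually (\<lambda>N. sqrt (K * infsum g (- fock_box N)) < e \<and> p \<in> fock_box N) sequentially"
      by (intro eventually_conj order_tendstoD(2)[OF lim] ev)
    then obtain N where N: "sqrt (K * infsum g (- fock_box N)) < e" "p \<in> fock_box N"
      by (auto simp: eventually_sequentially)
    from fock_state_approx[OF N(2), of a, folded g_def, folded K_def] N(1)
    show "\<exists>v \<in> span coherent_multiples. dist v (cscale a (fock_state p)) < e"
      by (force simp: dist_norm)
  qed
qed

lemma sum_in_closure_span:
  assumes "\<And>i. i \<in> I \<Longrightarrow> f i \<in> closure (span X)"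
  shows "(\<Sum>i\<in>I. f i) \<in> closure (span (X :: 'a::real_normed_vector set))"
  using assms
proof (induction I rule: infinite_finite_induct)
  case (insert i I)
  then have "f i \<in> closure (span X)" "sum f I \<in> closure (span X)" by auto
  then obtain s t where "\<forall>n. s n \<in> span X" "s \<longlonglongrightarrow> f i" "\<forall>n. t n \<in> span X" "t \<longlonglongrightarrow> sum f I"
    unfolding closure_sequential by blast
  then show ?case
    using insert.hyps unfolding closure_sequential
    by (intro exI[of _ "\<lambda>n. s n + t n"]) (auto intro: span_add tendsto_add)
qed (use closure_subset span_zero in auto)

text \<open>Truncations are finite combinations of Fock states, hence lie in the closure, and
  converge to the given state; closing twice adds nothing.\<close>

lemma closure_span_coherent: "closure (span coherent_multiples) = (UNIV :: 'm::finite fock set)"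
proof -
  have "\<psi> \<in> closure (closure (span coherent_multiples))" for \<psi> :: "'m fock"
    unfolding closure_sequential[of \<psi>]
  proof (intro exI conjI allI)
    show "fock_trunc (fock_box N) \<psi> \<in> closure (span coherent_multiples)" for N
      unfolding fock_trunc_eq_sum[OF finite_fock_box]
      by (intro sum_in_closure_span fock_state_in_closure)
  qed (rule fock_trunc_tendsto)
  then show ?thesis by auto
qed

subsection \<open>Kernels that depend bilinearly on one coordinate\<close>

text \<open>Expanding the vector coordinate in generators makes the kernel on the span a combination
  of values on \<open>G\<close>, with real coefficients. The index in \<open>I\<close> is a
  parameter, so that the two vectors in \<open>super_kernel\<close> can be treated one after the
  other.\<close>

lemma psd_kernel_span:
  fixes B :: "'i \<Rightarrow> 'i \<Rightarrow> 'v::real_normed_vector \<Rightarrow> 'v \<Rightarrow> complex"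
  assumes B: "\<And>i j. i \<in> I \<Longrightarrow> j \<in> I \<Longrightarrow> bounded_bilinear (B i j)"
    and psd: "psd_kernel (G \<times> I) (\<lambda>s t. B (snd s) (snd t) (fst s) (fst t))"
  shows "psd_kernel (span G \<times> I) (\<lambda>s t. B (snd s) (snd t) (fst s) (fst t))"
proof -
  have "\<exists>T r. finite T \<and> T \<subseteq> G \<and> v = (\<Sum>a\<in>T. r a *\<^sub>R a)" if "v \<in> span G" for v
    using that by (auto simp: span_explicit)
  then obtain T r where T: "\<And>v. v \<in> span G \<Longrightarrow> finite (T v)" "\<And>v. v \<in> span G \<Longrightarrow> T v \<subseteq> G"
    and r: "\<And>v. v \<in> span G \<Longrightarrow> v = (\<Sum>a\<in>T v. r v a *\<^sub>R a)"
    by metis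
  show ?thesis
  proof (rule psd_kernel_combination[OF psd, where T = "\<lambda>s. (\<lambda>a. (a, snd s)) ` T (fst s)"
        and a = "\<lambda>s t. complex_of_real (r (fst s) (fst t))"])
    fix s s' assume s: "s \<in> span G \<times> I" and s': "s' \<in> span G \<times> I"
    obtain v i w j where [simp]: "s = (v, i)" "s' = (w, j)" by fastforce
    have v: "v \<in> span G" "i \<in> I" and w: "w \<in> span G" "j \<in> I" using s s' by auto
    interpret bounded_bilinear "B i j" using B v w by blast
    have "B i j v w = B i j (\<Sum>a\<in>T v. r v a *\<^sub>R a) (\<Sum>b\<in>T w. r w b *\<^sub>R b)"
      using r[OF v(1)] r[OF w(1)] by simp
    also have "\<dots> = (\<Sum>a\<in>T v. \<Sum>b\<in>T w. complex_of_real (r v a) * B i j a b * complex_of_real (r w b))"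
      by (simp add: sum_left sum_right scaleR_left scaleR_right scaleR_conv_of_real
          sum_distrib_left mult_ac) (rule sum.swap)
    finally show "B (snd s) (snd s') (fst s) (fst s')
      = (\<Sum>t\<in>(\<lambda>a. (a, snd s)) ` T (fst s). \<Sum>t'\<in>(\<lambda>a. (a, snd s')) ` T (fst s').
          cnj (complex_of_real (r (fst s) (fst t))) * B (snd t) (snd t') (fst t) (fst t') *
          complex_of_real (r (fst s') (fst t')))"
      by (simp add: sum.reindex inj_on_def)
  qed (use T in fastforce)+
qed

text \<open>For each vector one approximating sequence in the span is fixed; the kernels pulled back
  along these sequences are positive and converge pointwise by continuity of
  \<open>B\<close>.\<close>

lemma psd_kernel_dense:
  fixes B :: "'i \<Rightarrow> 'i \<Rightarrow> 'v::real_normed_vector \<Rightarrow> 'v \<Rightarrow> complex"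
  assumes B: "\<And>i j. i \<in> I \<Longrightarrow> j \<in> I \<Longrightarrow> bounded_bilinear (B i j)"
    and psd: "psd_kernel (G \<times> I) (\<lambda>s t. B (snd s) (snd t) (fst s) (fst t))"
    and dense: "closure (span G) = UNIV"
  shows "psd_kernel (UNIV \<times> I) (\<lambda>s t. B (snd s) (snd t) (fst s) (fst t))"
proof -
  have "\<exists>\<sigma>. (\<forall>n. \<sigma> n \<in> span G) \<and> \<sigma> \<longlonglongrightarrow> v" for v :: 'v
    using dense by (auto simp: closure_sequential[symmetric])
  then obtain \<sigma> where \<sigma>: "\<And>v n. \<sigma> v n \<in> span G" "\<And>v :: 'v. \<sigma> v \<longlonglongrightarrow> v"
    by metis
  show ?thesis
  proof (rule psd_kernel_limit)
    show "psd_kernel (UNIV \<times> I)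
      (\<lambda>s t. B (snd s) (snd t) (\<sigma> (fst s) n) (\<sigma> (fst t) n))" for n
      using psd_kernel_comp[OF psd_kernel_span[OF B psd], where f = "\<lambda>s :: 'v \<times> 'i. (\<sigma> (fst s) n, snd s)"
          and Y = "UNIV \<times> I"] \<sigma>(1)
      by fastforce
    fix s t :: "'v \<times> 'i" assume "s \<in> UNIV \<times> I" "t \<in> UNIV \<times> I"
    then show "(\<lambda>n. B (snd s) (snd t) (\<sigma> (fst s) n) (\<sigma> (fst t) n))
        \<longlonglongrightarrow> B (snd s) (snd t) (fst s) (fst t)"
      by (intro bounded_bilinear.tendsto[OF B] \<sigma>(2)) auto
  qed
qed

subsection \<open>Nuclear representations\<close>

lemma ketbra_add_left: "ketbra (\<phi> + \<phi>') \<psi> = (\<lambda>\<xi>. ketbra \<phi> \<psi> \<xi> + ketbra \<phi>' \<psi> \<xi>)"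
  and ketbra_add_right: "ketbra \<phi> (\<psi> + \<psi>') = (\<lambda>\<xi>. ketbra \<phi> \<psi> \<xi> + ketbra \<phi> \<psi>' \<xi>)"
  and ketbra_cscale_left: "ketbra (cscale c \<phi>) \<psi> = (\<lambda>\<xi>. cscale c (ketbra \<phi> \<psi> \<xi>))"
  and ketbra_cscale_right: "ketbra \<phi> (cscale c \<psi>) = (\<lambda>\<xi>. cscale (cnj c) (ketbra \<phi> \<psi> \<xi>))"
  by (simp_all add: ketbra_def fun_eq_iff cscale_add_right cinner_add_left cscale_add_left
      cscale_cscale cinner_cscale_left mult.commute)

lemma ketbra_zero: "ketbra 0 \<psi> \<xi> = 0"
  by (simp add: ketbra_def cscale_zero_right)

text \<open>One term is put in front of the series; iteration reaches all finite sums of rank one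
  operators.\<close>

lemma nuclear_rep_add_ketbra:
  assumes "nuclear_rep T a b"
  shows "nuclear_rep (\<lambda>\<xi>. ketbra \<phi> \<psi> \<xi> + T \<xi>) (case_nat \<phi> a) (case_nat \<psi> b)"
  unfolding nuclear_rep_def
proof (intro conjI allI)
  show "summable (\<lambda>j. norm (case_nat \<phi> a j) * norm (case_nat \<psi> b j))"
    using assms by (subst summable_Suc_iff[symmetric]) (simp add: nuclear_rep_def)
  show "(\<lambda>j. ketbra (case_nat \<phi> a j) (case_nat \<psi> b j) \<xi>) sums (ketbra \<phi> \<psi> \<xi> + T \<xi>)" for \<xi>
    using assms sums_Suc[of "\<lambda>j. ketbra (case_nat \<phi> a j) (case_nat \<psi> b j) \<xi>" "T \<xi>"]
    by (simp add: nuclear_rep_def add.commute)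
qed

lemma nuclear_rep_zero: "nuclear_rep (\<lambda>_. 0) (\<lambda>_. 0) (\<lambda>_. 0)"
  by (simp add: nuclear_rep_def ketbra_zero)

lemma trace_class_zero: "trace_class (\<lambda>_. 0)"
  using nuclear_rep_zero by (auto simp: trace_class_def)

lemma nuclear_rep_ketbra: "nuclear_rep (ketbra \<phi> \<psi>) (case_nat \<phi> (\<lambda>_. 0)) (case_nat \<psi> (\<lambda>_. 0))"
  using nuclear_rep_add_ketbra[OF nuclear_rep_zero, of \<phi> \<psi>] by simp

lemma trace_class_ketbra: "trace_class (ketbra \<phi> \<psi>)"
  using nuclear_rep_ketbra by (auto simp: trace_class_def)

lemma trace_norm_le: "nuclear_rep T a b \<Longrightarrow> trace_norm T \<le> (\<Sum>j. norm (a j) * norm (b j))"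
  unfolding trace_norm_def
  by (rule cInf_lower) (auto intro!: bdd_belowI[of _ 0] suminf_nonneg simp: nuclear_rep_def)

lemma trace_norm_ketbra_le: "trace_norm (ketbra \<phi> \<psi>) \<le> norm \<phi> * norm \<psi>"
proof -
  have "(\<lambda>j. norm (case_nat \<phi> (\<lambda>_. 0) j) * norm (case_nat \<psi> (\<lambda>_. 0) j)) sums (norm \<phi> * norm \<psi>)"
    using sums_Suc[of "\<lambda>j. norm (case_nat \<phi> (\<lambda>_. 0) j) * norm (case_nat \<psi> (\<lambda>_. 0) j)" 0] by simp
  then show ?thesis using trace_norm_le[OF nuclear_rep_ketbra[of \<phi> \<psi>]] by (simp add: sums_unique[symmetric])
qed

text \<open>\<open>trace_class\<close> makes the set under the infimum nonempty; the infimum of the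
  empty set carries no information.\<close>

lemma trace_norm_nonneg: "trace_class T \<Longrightarrow> 0 \<le> trace_norm T"
  unfolding trace_norm_def trace_class_def
proof (rule cInf_greatest)
  show "0 \<le> r" if "r \<in> {\<Sum>j. norm (a j) * norm (b j) |a b. nuclear_rep T a b}" for r
    using that by (auto intro!: suminf_nonneg simp: nuclear_rep_def)
qed blast

text \<open>An \<open>operator\<close> is a bare function; linearity is inherited from the terms of
  a nuclear series by uniqueness of limits.\<close>

lemma trace_class_linear:
  assumes "trace_class T"
  shows "T (\<phi> + \<psi>) = T \<phi> + T \<psi>" and "T (cscale c \<phi>) = cscale c (T \<phi>)"
proof -
  obtain a b where s: "(\<lambda>j. ketbra (a j) (b j) \<psi>) sums T \<psi>" for \<psi>
    using assms by (auto simp: trace_class_def nuclear_rep_def)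
  have "(\<lambda>j. ketbra (a j) (b j) (\<phi> + \<psi>)) sums (T \<phi> + T \<psi>)"
    using sums_add[OF s[of \<phi>] s[of \<psi>]] by (simp add: ketbra_def cinner_add_right cscale_add_left)
  then show "T (\<phi> + \<psi>) = T \<phi> + T \<psi>" using s sums_unique2 by blast
  have "(\<lambda>j. ketbra (a j) (b j) (cscale c \<phi>)) sums (cscale c (T \<phi>))"
    using bounded_linear.sums[OF bounded_linear_cscale s[of \<phi>], of c]
    by (simp add: ketbra_def cinner_cscale_right cscale_cscale)
  then show "T (cscale c \<phi>) = cscale c (T \<phi>)" using s sums_unique2 by blast
qed

lemma trace_class_sum:
  assumes "trace_class T" and "finite I"
  shows "T (\<Sum>i\<in>I. f i) = (\<Sum>i\<in>I. T (f i))"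
  using assms(2)
proof (induction I rule: finite_induct)
  case empty
  show ?case using trace_class_linear(2)[OF assms(1), of 0 0] by (simp add: cscale_zero_left)
qed (simp add: trace_class_linear(1)[OF assms(1)])

text \<open>Termwise \<open>P |a><b| Q = |P a><Q' b|\<close>, where \<open>Q'\<close> is the adjoint
  of \<open>Q\<close>.\<close>

lemma nuclear_rep_compose:
  assumes rep: "nuclear_rep T a b"
    and P: "bounded_linear P" "\<And>c \<psi>. P (cscale c \<psi>) = cscale c (P \<psi>)" "\<And>\<psi>. norm (P \<psi>) \<le> K * norm \<psi>"
    and Q: "\<And>\<psi> \<xi>. cinner \<psi> (Q \<xi>) = cinner (Q' \<psi>) \<xi>" "\<And>\<psi>. norm (Q' \<psi>) \<le> L * norm \<psi>"
  shows "nuclear_rep (\<lambda>\<xi>. P (T (Q \<xi>))) (\<lambda>j. P (a j)) (\<lambda>j. Q' (b j))"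
  unfolding nuclear_rep_def
proof (intro conjI allI)
  show "summable (\<lambda>j. norm (P (a j)) * norm (Q' (b j)))"
  proof (rule summable_comparison_test)
    have "norm (P (a j)) * norm (Q' (b j)) \<le> (K * norm (a j)) * (L * norm (b j))" for j
      using P(3) Q(2) order_trans[OF norm_ge_zero P(3)] by (intro mult_mono) auto
    then show "\<exists>N. \<forall>j\<ge>N. norm (norm (P (a j)) * norm (Q' (b j))) \<le> K * L * (norm (a j) * norm (b j))"
      by (auto simp: mult_ac)
    show "summable (\<lambda>j. K * L * (norm (a j) * norm (b j)))"
      using rep by (intro summable_mult) (simp add: nuclear_rep_def)
  qed
  fix \<xi>
  have "(\<lambda>j. P (ketbra (a j) (b j) (Q \<xi>))) sums P (T (Q \<xi>))"
    using rep by (intro bounded_linear.sums[OF P(1)]) (simp add: nuclear_rep_def)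
  then show "(\<lambda>j. ketbra (P (a j)) (Q' (b j)) \<xi>) sums P (T (Q \<xi>))"
    by (simp add: ketbra_def P(2) Q(1))
qed

subsection \<open>Superoperators\<close>

context
  fixes \<Phi> :: "'m::finite operator \<Rightarrow> 'm operator"
  assumes \<Phi>: "superoperator \<Phi>"
begin

lemma super_add:
  "trace_class \<rho> \<Longrightarrow> trace_class \<sigma> \<Longrightarrow> \<Phi> (\<lambda>\<psi>. \<rho> \<psi> + \<sigma> \<psi>) = (\<lambda>\<psi>. \<Phi> \<rho> \<psi> + \<Phi> \<sigma> \<psi>)"
  using \<Phi> by (simp add: superoperator_def)

lemma super_cscale: "trace_class \<rho> \<Longrightarrow> \<Phi> (\<lambda>\<psi>. cscale c (\<rho> \<psi>)) = (\<lambda>\<psi>. cscale c (\<Phi> \<rho> \<psi>))"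
  using \<Phi> by (simp add: superoperator_def)

lemma super_zero: "\<Phi> (\<lambda>_. 0) = (\<lambda>_. 0)"
  using super_cscale[OF trace_class_zero, of 0] by (simp add: cscale_zero_left)

lemma super_bounded_linear: "trace_class \<rho> \<Longrightarrow> bounded_linear (\<Phi> \<rho>)"
  and super_value_cscale: "trace_class \<rho> \<Longrightarrow> \<Phi> \<rho> (cscale c \<psi>) = cscale c (\<Phi> \<rho> \<psi>)"
  using \<Phi> by (simp_all add: superoperator_def bounded_operator_def)

text \<open>The constant is made nonnegative so that the trace norm may be replaced by any upper
  bound \<open>t\<close>, such as the sum of one particular nuclear series.\<close>

lemma super_bound:
  obtains C where "0 \<le> C"
    "\<And>\<rho> \<psi> t. trace_class \<rho> \<Longrightarrow> trace_norm \<rho> \<le> t \<Longrightarrow> norm (\<Phi> \<rho> \<psi>) \<le> C * t * norm \<psi>"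
proof -
  obtain C where C: "\<And>\<rho> \<psi>. trace_class \<rho> \<Longrightarrow> norm (\<Phi> \<rho> \<psi>) \<le> C * trace_norm \<rho> * norm \<psi>"
    using \<Phi> unfolding superoperator_def by blast
  show ?thesis
  proof (rule that[of "\<bar>C\<bar>"])
    fix \<rho> :: "'m operator" and \<psi> :: "'m fock" and t :: real assume \<rho>: "trace_class \<rho>" "trace_norm \<rho> \<le> t"
    have "C * trace_norm \<rho> * norm \<psi> \<le> \<bar>C\<bar> * t * norm \<psi>"
      using trace_norm_nonneg[OF \<rho>(1)] \<rho>(2) by (intro mult_right_mono mult_mono) auto
    then show "norm (\<Phi> \<rho> \<psi>) \<le> \<bar>C\<bar> * t * norm \<psi>"
      using C[OF \<rho>(1), of \<psi>] by linarith
  qed simp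
qed

lemma bounded_bilinear_super_ketbra: "bounded_bilinear (\<lambda>\<phi> \<phi>'. \<Phi> (ketbra \<phi> \<phi>') \<psi>)"
proof
  obtain C where C: "0 \<le> C"
    "\<And>\<rho> \<psi> t. trace_class \<rho> \<Longrightarrow> trace_norm \<rho> \<le> t \<Longrightarrow> norm (\<Phi> \<rho> \<psi>) \<le> C * t * norm \<psi>"
    by (rule super_bound) blast
  have "norm (\<Phi> (ketbra \<phi> \<phi>') \<psi>) \<le> norm \<phi> * norm \<phi>' * (C * norm \<psi>)" for \<phi> \<phi>'
    using C(2)[OF trace_class_ketbra trace_norm_ketbra_le, of \<phi> \<phi>' \<psi>] by (simp add: mult_ac)
  then show "\<exists>K. \<forall>\<phi> \<phi>'. norm (\<Phi> (ketbra \<phi> \<phi>') \<psi>) \<le> norm \<phi> * norm \<phi>' * K"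
    by blast
qed (simp_all add: ketbra_add_left ketbra_add_right super_add trace_class_ketbra scaleR_cscale
    ketbra_cscale_left ketbra_cscale_right super_cscale)

text \<open>Both claims go through one induction, since \<open>\<Phi>\<close> is additive on trace
  class operators and the partial sum must be known to be one.\<close>

lemma super_finite_ketbra:
  assumes "finite F"
  shows "trace_class (\<lambda>\<xi>. \<Sum>k\<in>F. cscale (m k) (ketbra (a k) (b k) \<xi>))"
    and "\<Phi> (\<lambda>\<xi>. \<Sum>k\<in>F. cscale (m k) (ketbra (a k) (b k) \<xi>)) \<psi>
      = (\<Sum>k\<in>F. cscale (m k) (\<Phi> (ketbra (a k) (b k)) \<psi>))"
  using assms
proof (induction F rule: finite_induct)
  case empty
  { case 1 show ?case by (simp add: trace_class_zero) }
  { case 2 show ?case by (simp add: super_zero) }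
next
  case (insert k F)
  define T where "T \<xi> = (\<Sum>k\<in>F. cscale (m k) (ketbra (a k) (b k) \<xi>))" for \<xi>
  have eq: "(\<lambda>\<xi>. \<Sum>k\<in>insert k F. cscale (m k) (ketbra (a k) (b k) \<xi>))
      = (\<lambda>\<xi>. ketbra (cscale (m k) (a k)) (b k) \<xi> + T \<xi>)"
    using insert.hyps by (simp add: T_def ketbra_cscale_left)
  have T: "trace_class T" using insert.IH(1) unfolding T_def .
  { case 1 show ?case
      unfolding eq using T nuclear_rep_add_ketbra unfolding trace_class_def by blast }
  { case 2 show ?case
      unfolding eq super_add[OF trace_class_ketbra T]
      using insert.hyps insert.IH(2)
      by (simp add: T_def[abs_def] ketbra_cscale_left super_cscale trace_class_ketbra) }
qed

text \<open>Truncation converges in trace norm, by dominated convergence in the series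
  \<open>T = (\<Sum>j. |a j\<rangle>\<langle>b j|)\<close>.\<close>

lemma super_trunc_tendsto:
  assumes T: "trace_class T"
  shows "(\<lambda>N. \<Phi> (\<lambda>\<xi>. fock_trunc (fock_box N) (T (fock_trunc (fock_box N) \<xi>))) \<psi>) \<longlonglongrightarrow> \<Phi> T \<psi>"
proof -
  obtain a b where rep: "nuclear_rep T a b" using T by (auto simp: trace_class_def)
  then have sm: "summable (\<lambda>j. norm (a j) * norm (b j))" by (simp add: nuclear_rep_def)
  define P where "P N = fock_trunc (fock_box N :: (nat ^ 'm) set)" for N
  define P' where "P' N \<xi> = \<xi> - P N \<xi>" for N \<xi>
  note lin = bounded_linear_fock_trunc
  have P: "bounded_linear (P N)" "P N (cscale c \<xi>) = cscale c (P N \<xi>)" "norm (P N \<xi>) \<le> 1 * norm \<xi>"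
      "cinner \<xi> (P N \<xi>') = cinner (P N \<xi>) \<xi>'" for N c \<xi> \<xi>'
    by (simp_all add: P_def lin fock_trunc_cscale norm_fock_trunc_le cinner_fock_trunc)
  have P': "bounded_linear (P' N)" "P' N (cscale c \<xi>) = cscale c (P' N \<xi>)" "norm (P' N \<xi>) \<le> 2 * norm \<xi>"
      "cinner \<xi> (P' N \<xi>') = cinner (P' N \<xi>) \<xi>'" for N c \<xi> \<xi>'
  proof -
    show "bounded_linear (P' N)"
      unfolding P'_def[abs_def] by (intro bounded_linear_sub bounded_linear_ident P(1))
    \<comment> \<open>The constant 2 is that of the triangle inequality; uniformity in
      \<open>N\<close> is what domination requires.\<close>
    show "norm (P' N \<xi>) \<le> 2 * norm \<xi>"
      using norm_triangle_ineq4[of \<xi> "P N \<xi>"] P(3)[of N \<xi>] by (simp add: P'_def)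
    show "cinner \<xi> (P' N \<xi>') = cinner (P' N \<xi>) \<xi>'"
      using P(4)[of \<xi> N \<xi>'] by (simp add: P'_def cinner_diff_left cinner_diff_right)
  qed (simp add: P'_def P(2) cscale_diff_right)
  have lim: "(\<lambda>N. P' N \<xi>) \<longlonglongrightarrow> 0" for \<xi>
    using tendsto_diff[OF tendsto_const fock_trunc_tendsto[of \<xi>], of \<xi>] by (simp add: P'_def P_def)
  \<comment> \<open>The error splits as \<open>T - P T P = P' T + P T P'\<close>. The sums
    \<open>s1\<close> and \<open>s2\<close> bound the trace norms of the two terms, and in each of
    their summands the factor with \<open>P'\<close> tends to 0.\<close>
  define s1 where "s1 N = (\<Sum>j. norm (P' N (a j)) * norm (b j))" for N
  define s2 where "s2 N = (\<Sum>j. norm (P N (a j)) * norm (P' N (b j)))" for N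
  have "s1 \<longlonglongrightarrow> (\<Sum>j::nat. 0)"
    unfolding s1_def[abs_def]
  proof (rule tannerys_theorem[THEN conjunct2, THEN conjunct2])
    show "(\<lambda>N. norm (P' N (a j)) * norm (b j)) \<longlonglongrightarrow> 0" for j
      using tendsto_mult[OF tendsto_norm[OF lim] tendsto_const] by simp
    have "norm (P' N (a j)) * norm (b j) \<le> 2 * (norm (a j) * norm (b j))" for N j
      using mult_right_mono[OF P'(3)[of N "a j"], of "norm (b j)"] by (simp add: mult.assoc)
    then show "\<forall>\<^sub>F (j, N) in at_top \<times>\<^sub>F sequentially.
        norm (norm (P' N (a j)) * norm (b j)) \<le> 2 * (norm (a j) * norm (b j))"
      by (intro always_eventually) auto
  qed (use sm in \<open>auto intro: summable_mult\<close>)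
  then have s1: "s1 \<longlonglongrightarrow> 0" by simp
  have "s2 \<longlonglongrightarrow> (\<Sum>j::nat. 0)"
    unfolding s2_def[abs_def]
  proof (rule tannerys_theorem[THEN conjunct2, THEN conjunct2])
    show "(\<lambda>N. norm (P N (a j)) * norm (P' N (b j))) \<longlonglongrightarrow> 0" for j
      using tendsto_mult[OF tendsto_norm[OF fock_trunc_tendsto[of "a j"]] tendsto_norm[OF lim[of "b j"]]]
      by (simp add: P_def)
    have "norm (P N (a j)) * norm (P' N (b j)) \<le> 2 * (norm (a j) * norm (b j))" for N j
      using mult_mono[OF P(3)[of N "a j"] P'(3)[of N "b j"]] by (simp add: mult_ac)
    then show "\<forall>\<^sub>F (j, N) in at_top \<times>\<^sub>F sequentially.
        norm (norm (P N (a j)) * norm (P' N (b j))) \<le> 2 * (norm (a j) * norm (b j))"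
      by (intro always_eventually) auto
  qed (use sm in \<open>auto intro: summable_mult\<close>)
  then have s2: "s2 \<longlonglongrightarrow> 0" by simp
  obtain C where C: "0 \<le> C"
    "\<And>\<rho> \<psi> t. trace_class \<rho> \<Longrightarrow> trace_norm \<rho> \<le> t \<Longrightarrow> norm (\<Phi> \<rho> \<psi>) \<le> C * t * norm \<psi>"
    by (rule super_bound) blast
  have bound: "norm (\<Phi> (\<lambda>\<xi>. P N (T (P N \<xi>))) \<psi> - \<Phi> T \<psi>) \<le> C * s1 N * norm \<psi> + C * s2 N * norm \<psi>" for N
  proof -
    have r1: "nuclear_rep (\<lambda>\<xi>. P' N (T \<xi>)) (\<lambda>j. P' N (a j)) b"
      by (rule nuclear_rep_compose[OF rep P'(1,2,3), where Q = "\<lambda>\<xi>. \<xi>" and L = 1]) auto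
    have r2: "nuclear_rep (\<lambda>\<xi>. P N (T (P' N \<xi>))) (\<lambda>j. P N (a j)) (\<lambda>j. P' N (b j))"
      by (rule nuclear_rep_compose[OF rep P(1,2,3) P'(4,3)])
    have r3: "nuclear_rep (\<lambda>\<xi>. P N (T (P N \<xi>))) (\<lambda>j. P N (a j)) (\<lambda>j. P N (b j))"
      by (rule nuclear_rep_compose[OF rep P(1,2,3) P(4,3)])
    have t: "trace_class (\<lambda>\<xi>. P' N (T \<xi>))" "trace_class (\<lambda>\<xi>. P N (T (P' N \<xi>)))"
        "trace_class (\<lambda>\<xi>. P N (T (P N \<xi>)))"
      using r1 r2 r3 by (auto simp: trace_class_def)
    have "(\<lambda>\<xi>. P N (T (P' N \<xi>)) + P N (T (P N \<xi>))) = (\<lambda>\<xi>. P N (T \<xi>))"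
    proof
      fix \<xi>
      have "P N (T (P' N \<xi>)) + P N (T (P N \<xi>)) = P N (T (P' N \<xi> + P N \<xi>))"
        by (simp only: trace_class_linear(1)[OF T] linear_add[OF bounded_linear.linear[OF P(1)]])
      then show "P N (T (P' N \<xi>)) + P N (T (P N \<xi>)) = P N (T \<xi>)" by (simp add: P'_def)
    qed
    then have 1: "\<Phi> (\<lambda>\<xi>. P N (T \<xi>)) \<psi>
        = \<Phi> (\<lambda>\<xi>. P N (T (P' N \<xi>))) \<psi> + \<Phi> (\<lambda>\<xi>. P N (T (P N \<xi>))) \<psi>"
      using super_add[OF t(2,3)] by simp
    have r4: "nuclear_rep (\<lambda>\<xi>. P N (T \<xi>)) (\<lambda>j. P N (a j)) b"
      by (rule nuclear_rep_compose[OF rep P(1,2,3), where Q = "\<lambda>\<xi>. \<xi>" and L = 1]) auto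
    then have "trace_class (\<lambda>\<xi>. P N (T \<xi>))" by (auto simp: trace_class_def)
    from super_add[OF t(1) this] have 2: "\<Phi> T \<psi> = \<Phi> (\<lambda>\<xi>. P' N (T \<xi>)) \<psi> + \<Phi> (\<lambda>\<xi>. P N (T \<xi>)) \<psi>"
      by (simp add: P'_def)
    have "norm (\<Phi> (\<lambda>\<xi>. P N (T (P N \<xi>))) \<psi> - \<Phi> T \<psi>)
        = norm (\<Phi> (\<lambda>\<xi>. P' N (T \<xi>)) \<psi> + \<Phi> (\<lambda>\<xi>. P N (T (P' N \<xi>))) \<psi>)"
      unfolding 1 2 by (subst norm_minus_cancel[symmetric]) (simp add: algebra_simps)
    also have "\<dots> \<le> norm (\<Phi> (\<lambda>\<xi>. P' N (T \<xi>)) \<psi>) + norm (\<Phi> (\<lambda>\<xi>. P N (T (P' N \<xi>))) \<psi>)"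
      by (rule norm_triangle_ineq)
    also have "\<dots> \<le> C * s1 N * norm \<psi> + C * s2 N * norm \<psi>"
      unfolding s1_def s2_def
      by (intro add_mono C(2) t trace_norm_le r1 r2)
    finally show ?thesis .
  qed
  have "(\<lambda>N. C * s1 N * norm \<psi> + C * s2 N * norm \<psi>) \<longlonglongrightarrow> C * 0 * norm \<psi> + C * 0 * norm \<psi>"
    by (intro tendsto_intros s1 s2)
  then have "(\<lambda>N. C * s1 N * norm \<psi> + C * s2 N * norm \<psi>) \<longlonglongrightarrow> 0" by simp
  with always_eventually[OF allI[OF bound]]
  have "(\<lambda>N. \<Phi> (\<lambda>\<xi>. P N (T (P N \<xi>))) \<psi> - \<Phi> T \<psi>) \<longlonglongrightarrow> 0"
    by (rule Lim_null_comparison)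
  then show ?thesis by (simp add: P_def LIM_zero_iff)
qed

end

subsection \<open>Complete positivity as positivity of a kernel\<close>

text \<open>These are the matrix elements of the Choi operator between product vectors, the input
  vector being conjugated in the Fock basis.\<close>

definition super_kernel ::
    "('m::finite operator \<Rightarrow> 'm operator) \<Rightarrow> 'm fock \<times> 'm fock \<Rightarrow> 'm fock \<times> 'm fock \<Rightarrow> complex"
  where "super_kernel \<Phi> s t = cinner (fst s) (\<Phi> (ketbra (snd s) (snd t)) (fst t))"

text \<open>The prefactor has the shape \<open>cnj d * K * d'\<close> with
  \<open>d = a * cnj b\<close> and \<open>d' = a' * cnj b'\<close>, so scalar multiples of the
  vectors act as a rescaling of the kernel.\<close>

lemma super_kernel_cscale:
  assumes \<Phi>: "superoperator \<Phi>"
  shows "super_kernel \<Phi> (cscale a \<phi>, cscale b \<psi>) (cscale a' \<phi>', cscale b' \<psi>')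
    = cnj a * b * super_kernel \<Phi> (\<phi>, \<psi>) (\<phi>', \<psi>') * a' * cnj b'"
proof -
  have "ketbra (cscale b \<psi>) (cscale b' \<psi>') = (\<lambda>\<xi>. cscale (b * cnj b') (ketbra \<psi> \<psi>' \<xi>))"
    by (simp add: ketbra_def cinner_cscale_left cscale_cscale mult_ac)
  then show ?thesis
    by (simp add: super_kernel_def super_cscale[OF \<Phi>] super_value_cscale[OF \<Phi>] trace_class_ketbra
        cinner_cscale_left cinner_cscale_right)
qed

lemma bounded_bilinear_linear_comp:
  assumes "bounded_linear f" "bounded_bilinear B"
  shows "bounded_bilinear (\<lambda>x y. f (B x y))"
proof -
  interpret f: bounded_linear f by fact
  interpret B: bounded_bilinear B by fact
  obtain K L where KL: "\<And>x. norm (f x) \<le> norm x * K" "0 \<le> K" "\<And>x y. norm (B x y) \<le> norm x * norm y * L"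
    using f.nonneg_bounded B.bounded by blast
  show ?thesis
  proof
    have "norm (f (B x y)) \<le> norm x * norm y * (L * K)" for x y
      using order_trans[OF KL(1) mult_right_mono[OF KL(3,2)]] by (simp add: mult.assoc)
    then show "\<exists>K. \<forall>x y. norm (f (B x y)) \<le> norm x * norm y * K" by blast
  qed (simp_all add: f.add f.scaleR B.add_left B.add_right B.scaleR_left B.scaleR_right)
qed

text \<open>The output vector is extended first while the input vector stays in \<open>G\<close>;
  after a swap of coordinates the input vector follows.\<close>

lemma psd_kernel_super_dense:
  fixes \<Phi> :: "'m::finite operator \<Rightarrow> 'm operator"
  assumes \<Phi>: "superoperator \<Phi>" and dense: "closure (span G) = UNIV"
    and psd: "psd_kernel (G \<times> G) (super_kernel \<Phi>)"
  shows "psd_kernel UNIV (super_kernel \<Phi>)"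
proof -
  have "psd_kernel (UNIV \<times> G)
      (\<lambda>s t. (\<lambda>\<phi> \<phi>' \<psi> \<psi>'. cinner \<psi> (\<Phi> (ketbra \<phi> \<phi>') \<psi>')) (snd s) (snd t) (fst s) (fst t))"
  proof (rule psd_kernel_dense[OF _ _ dense])
    show "bounded_bilinear (\<lambda>\<psi> \<psi>'. cinner \<psi> (\<Phi> (ketbra \<phi> \<phi>') \<psi>'))" for \<phi> \<phi>'
      by (rule bounded_bilinear.comp[OF bounded_bilinear_cinner bounded_linear_ident
            super_bounded_linear[OF \<Phi> trace_class_ketbra]])
  qed (use psd in \<open>simp add: super_kernel_def[abs_def]\<close>)
  then have "psd_kernel (G \<times> UNIV)
      (\<lambda>s t. (\<lambda>\<psi> \<psi>' \<phi> \<phi>'. cinner \<psi> (\<Phi> (ketbra \<phi> \<phi>') \<psi>')) (snd s) (snd t) (fst s) (fst t))"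
    using psd_kernel_comp[where f = prod.swap and X = "UNIV \<times> G" and Y = "G \<times> UNIV"]
    by force
  then have "psd_kernel (UNIV \<times> UNIV)
      (\<lambda>s t. (\<lambda>\<psi> \<psi>' \<phi> \<phi>'. cinner \<psi> (\<Phi> (ketbra \<phi> \<phi>') \<psi>')) (snd s) (snd t) (fst s) (fst t))"
  proof (intro psd_kernel_dense[OF _ _ dense])
    show "bounded_bilinear (\<lambda>\<phi> \<phi>'. cinner \<psi> (\<Phi> (ketbra \<phi> \<phi>') \<psi>'))" for \<psi> \<psi>'
      by (rule bounded_bilinear_linear_comp
          [OF bounded_bilinear.bounded_linear_right[OF bounded_bilinear_cinner]
             bounded_bilinear_super_ketbra[OF \<Phi>]])
  qed
  from psd_kernel_comp[OF this, where f = prod.swap and Y = UNIV]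
  show ?thesis by (simp add: super_kernel_def[abs_def])
qed

text \<open>Block positivity tests one vector per row. The points of \<open>S\<close> are grouped by
  their row, and each group is merged into the single vector \<open>\<psi> i\<close> by
  linearity.\<close>

lemma psd_kernel_block:
  assumes R: "\<And>i j. i < n \<Longrightarrow> j < n \<Longrightarrow> trace_class (R i j)" and pos: "block_positive n R"
  shows "psd_kernel ({..<n} \<times> UNIV) (\<lambda>s t. cinner (snd s) (R (fst s) (fst t) (snd t)))"
  unfolding psd_kernel_def
proof (intro allI impI, elim conjE)
  fix S :: "(nat \<times> 'a fock) set" and x
  assume S: "finite S" "S \<subseteq> {..<n} \<times> UNIV"
  define \<psi> where "\<psi> i = (\<Sum>s\<in>{s\<in>S. fst s = i}. cscale (x s) (snd s))" for i
  define h where "h s t = cnj (x s) * cinner (snd s) (R (fst s) (fst t) (snd t)) * x t" for s t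
  have "cinner (\<psi> i) (R i j (\<psi> j)) = (\<Sum>s\<in>{s\<in>S. fst s = i}. \<Sum>t\<in>{t\<in>S. fst t = j}. h s t)"
    if ij: "i < n" "j < n" for i j
  proof -
    have "R i j (\<psi> j) = (\<Sum>t\<in>{t\<in>S. fst t = j}. cscale (x t) (R i j (snd t)))"
      using S R[OF ij] by (simp add: \<psi>_def trace_class_sum trace_class_linear(2))
    then have "cinner (\<psi> i) (R i j (\<psi> j)) = (\<Sum>s\<in>{s\<in>S. fst s = i}. cnj (x s) *
        (\<Sum>t\<in>{t\<in>S. fst t = j}. x t * cinner (snd s) (R i j (snd t))))"
      by (simp add: \<psi>_def cinner_sum_left cinner_cscale_left)
        (simp add: cinner_sum_right cinner_cscale_right)
    then show ?thesis
      by (simp add: h_def sum_distrib_left mult_ac)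
  qed
  then have "(\<Sum>i<n. \<Sum>j<n. cinner (\<psi> i) (R i j (\<psi> j)))
      = (\<Sum>i<n. \<Sum>j<n. \<Sum>s\<in>{s\<in>S. fst s = i}. \<Sum>t\<in>{t\<in>S. fst t = j}. h s t)"
    by simp
  also have "\<dots> = (\<Sum>i<n. \<Sum>s\<in>{s\<in>S. fst s = i}. \<Sum>j<n. \<Sum>t\<in>{t\<in>S. fst t = j}. h s t)"
    by (rule sum.cong[OF refl], rule sum.swap)
  also have "\<dots> = (\<Sum>s\<in>S. \<Sum>j<n. \<Sum>t\<in>{t\<in>S. fst t = j}. h s t)"
    using S by (intro sum.group) auto
  also have "\<dots> = (\<Sum>s\<in>S. \<Sum>t\<in>S. h s t)"
    using S by (intro sum.cong[OF refl] sum.group) auto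
  finally show "0 \<le> (\<Sum>s\<in>S. \<Sum>t\<in>S. cnj (x s) * cinner (snd s) (R (fst s) (fst t) (snd t)) * x t)"
    using pos unfolding block_positive_def h_def by metis
qed

text \<open>The matrix elements of \<open>R\<close> become explicit coefficients, ready to be paired
  entrywise with the values of \<open>\<Phi>\<close> on rank one operators of Fock states.\<close>

lemma fock_trunc_sandwich:
  assumes B: "finite B" and R: "trace_class R"
  shows "fock_trunc B (R (fock_trunc B \<xi>))
    = (\<Sum>k\<in>B \<times> B. cscale (cinner (fock_state (fst k)) (R (fock_state (snd k))))
        (ketbra (fock_state (fst k)) (fock_state (snd k)) \<xi>))"
proof -
  have "R (fock_trunc B \<xi>) = (\<Sum>q\<in>B. cscale (fock_coeff \<xi> q) (R (fock_state q)))"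
    using B by (simp add: fock_trunc_eq_sum trace_class_sum[OF R] trace_class_linear(2)[OF R])
  then have "fock_trunc B (R (fock_trunc B \<xi>))
      = (\<Sum>p\<in>B. cscale (\<Sum>q\<in>B. fock_coeff \<xi> q * fock_coeff (R (fock_state q)) p) (fock_state p))"
    using B by (subst fock_trunc_eq_sum) (simp_all add: fock_coeff_sum)
  also have "\<dots> = (\<Sum>p\<in>B. \<Sum>q\<in>B. cscale (fock_coeff \<xi> q * fock_coeff (R (fock_state q)) p) (fock_state p))"
  proof -
    have "cscale (\<Sum>q\<in>B. m q) \<phi> = (\<Sum>q\<in>B. cscale (m q) \<phi>)" for m and \<phi> :: "'a fock"
      by (rule fock_eqI) (simp add: fock_coeff_sum sum_distrib_right)
    then show ?thesis by simp
  qed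
  also have "\<dots> = (\<Sum>(p, q)\<in>B \<times> B. cscale (fock_coeff \<xi> q * fock_coeff (R (fock_state q)) p) (fock_state p))"
    by (rule sum.cartesian_product)
  finally show ?thesis
    by (simp add: ketbra_def cinner_fock_state cscale_cscale case_prod_beta mult.commute)
qed

lemma completely_positive_iff_psd_kernel:
  fixes \<Phi> :: "'m::finite operator \<Rightarrow> 'm operator"
  assumes \<Phi>: "superoperator \<Phi>"
  shows "completely_positive \<Phi> \<longleftrightarrow> psd_kernel UNIV (super_kernel \<Phi>)"
proof
  assume cp: "completely_positive \<Phi>"
  show "psd_kernel UNIV (super_kernel \<Phi>)"
    unfolding psd_kernel_def
  proof (intro allI impI, elim conjE)
    fix S :: "('m fock \<times> 'm fock) set" and x assume S: "finite S"
    \<comment> \<open>Arrays of operators are indexed by numbers, so the points of \<open>S\<close>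
      are enumerated. With the rank one entries \<open>R i j\<close> below, the form of the image
      array is the kernel form on \<open>S\<close>.\<close>
    obtain h where h: "bij_betw h {0..<card S} S" using ex_bij_betw_nat_finite[OF S] by blast
    define n where "n = card S"
    have h: "bij_betw h {..<n} S" using h by (simp add: n_def atLeast0LessThan)
    define R where "R i j = ketbra (snd (h i)) (snd (h j))" for i j
    define \<psi> where "\<psi> i = cscale (x (h i)) (fst (h i))" for i
    have "block_positive n R"
      unfolding block_positive_def
    proof
      fix \<psi> :: "nat \<Rightarrow> 'm fock"
      \<comment> \<open>The form factorizes into the squared modulus of a single sum, an instance of
        the constant kernel 1.\<close>
      have "(\<Sum>i<n. \<Sum>j<n. cinner (\<psi> i) (R i j (\<psi> j)))
          = (\<Sum>i<n. \<Sum>j<n. cnj (cinner (snd (h i)) (\<psi> i)) * 1 * cinner (snd (h j)) (\<psi> j))"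
        by (intro sum.cong refl)
          (simp add: R_def ketbra_def cinner_cscale_right cinner_cnj[symmetric] mult.commute)
      also have "0 \<le> \<dots>"
        by (rule psd_kernelD[OF psd_kernel_const, of 1 "{..<n}" UNIV]) (auto simp: less_eq_complex_def)
      finally show "0 \<le> (\<Sum>i<n. \<Sum>j<n. cinner (\<psi> i) (R i j (\<psi> j)))" .
    qed
    moreover have "\<forall>i<n. \<forall>j<n. trace_class (R i j)"
      by (simp add: R_def trace_class_ketbra)
    ultimately have "block_positive n (\<lambda>i j. \<Phi> (R i j))"
      using cp unfolding completely_positive_def by blast
    then have "0 \<le> (\<Sum>i<n. \<Sum>j<n. cinner (\<psi> i) (\<Phi> (R i j) (\<psi> j)))"
      by (simp add: block_positive_def)
    also have "\<dots> = (\<Sum>i<n. \<Sum>j<n. cnj (x (h i)) * super_kernel \<Phi> (h i) (h j) * x (h j))"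
      by (intro sum.cong refl) (simp add: \<psi>_def R_def super_kernel_def cinner_cscale_left
          cinner_cscale_right super_value_cscale[OF \<Phi>] trace_class_ketbra)
    also have "\<dots> = (\<Sum>s\<in>S. \<Sum>j<n. cnj (x s) * super_kernel \<Phi> s (h j) * x (h j))"
      by (rule sum.reindex_bij_betw[OF h])
    also have "\<dots> = (\<Sum>s\<in>S. \<Sum>t\<in>S. cnj (x s) * super_kernel \<Phi> s t * x t)"
      by (rule sum.cong[OF refl], rule sum.reindex_bij_betw[OF h])
    finally show "0 \<le> (\<Sum>s\<in>S. \<Sum>t\<in>S. cnj (x s) * super_kernel \<Phi> s t * x t)" .
  qed
next
  assume psd: "psd_kernel UNIV (super_kernel \<Phi>)"
  show "completely_positive \<Phi>"
    unfolding completely_positive_def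
  proof (intro allI impI, elim conjE)
    fix n and R :: "nat \<Rightarrow> nat \<Rightarrow> 'm operator"
    assume tc: "\<forall>i<n. \<forall>j<n. trace_class (R i j)" and pos: "block_positive n R"
    show "block_positive n (\<lambda>i j. \<Phi> (R i j))"
      unfolding block_positive_def
    proof
      fix \<psi> :: "nat \<Rightarrow> 'm fock"
      define P where "P N = fock_trunc (fock_box N :: (nat ^ 'm) set)" for N
      show "0 \<le> (\<Sum>i<n. \<Sum>j<n. cinner (\<psi> i) (\<Phi> (R i j) (\<psi> j)))"
      proof (rule complex_nonneg_limit)
        show "(\<lambda>N. \<Sum>i<n. \<Sum>j<n. cinner (\<psi> i) (\<Phi> (\<lambda>\<xi>. P N (R i j (P N \<xi>))) (\<psi> j)))
            \<longlonglongrightarrow> (\<Sum>i<n. \<Sum>j<n. cinner (\<psi> i) (\<Phi> (R i j) (\<psi> j)))"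
          unfolding P_def using tc
          by (intro tendsto_sum bounded_bilinear.tendsto[OF bounded_bilinear_cinner] tendsto_const
              super_trunc_tendsto[OF \<Phi>]) auto
        fix N
        define B where "B = (fock_box N :: (nat ^ 'm) set)"
        have B: "finite B" by (simp add: B_def finite_fock_box)
        \<comment> \<open>\<open>M\<close> is the matrix of the cut-off array and \<open>L\<close>
          holds the matrix elements of \<open>\<Phi>\<close> on rank one operators of Fock states.
          Their unweighted pairing is the form of the image of the cut-off array.\<close>
        define M where "M s t = cinner (fock_state (snd s)) (R (fst s) (fst t) (fock_state (snd t)))"
          for s t :: "nat \<times> (nat ^ 'm)"
        define L where "L s t = super_kernel \<Phi> (\<psi> (fst s), fock_state (snd s)) (\<psi> (fst t), fock_state (snd t))"
          for s t :: "nat \<times> (nat ^ 'm)"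
        have "(\<lambda>s. (fst s, fock_state (snd s))) ` ({..<n} \<times> B) \<subseteq> {..<n} \<times> UNIV"
          by auto
        from psd_kernel_comp[OF psd_kernel_block[OF _ pos] this] tc
        have "psd_kernel ({..<n} \<times> B) M"
          by (simp add: M_def[abs_def])
        moreover have "psd_kernel ({..<n} \<times> B) L"
          unfolding L_def by (rule psd_kernel_comp[OF psd]) simp
        ultimately have "0 \<le> (\<Sum>s\<in>{..<n} \<times> B. \<Sum>t\<in>{..<n} \<times> B. M s t * L s t)"
          using B by (intro Schur_sum_nonneg) auto
        also have "\<dots> = (\<Sum>i<n. \<Sum>p\<in>B. \<Sum>j<n. \<Sum>q\<in>B. M (i, p) (j, q) * L (i, p) (j, q))"
          by (simp only: sum.cartesian_product')
        also have "\<dots> = (\<Sum>i<n. \<Sum>j<n. \<Sum>p\<in>B. \<Sum>q\<in>B. M (i, p) (j, q) * L (i, p) (j, q))"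
          by (rule sum.cong[OF refl], rule sum.swap)
        also have "\<dots> = (\<Sum>i<n. \<Sum>j<n. cinner (\<psi> i) (\<Phi> (\<lambda>\<xi>. P N (R i j (P N \<xi>))) (\<psi> j)))"
        proof (intro sum.cong[OF refl])
          fix i j assume "i \<in> {..<n}" "j \<in> {..<n}"
          then have R: "trace_class (R i j)" using tc by auto
          have "\<Phi> (\<lambda>\<xi>. P N (R i j (P N \<xi>))) (\<psi> j) = (\<Sum>k\<in>B \<times> B.
              cscale (M (i, fst k) (j, snd k)) (\<Phi> (ketbra (fock_state (fst k)) (fock_state (snd k))) (\<psi> j)))"
            unfolding P_def B_def[symmetric] fock_trunc_sandwich[OF B R]
            using B by (simp add: super_finite_ketbra(2)[OF \<Phi>] M_def)
          then have "cinner (\<psi> i) (\<Phi> (\<lambda>\<xi>. P N (R i j (P N \<xi>))) (\<psi> j))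
              = (\<Sum>k\<in>B \<times> B. M (i, fst k) (j, snd k) * L (i, fst k) (j, snd k))"
            by (simp add: cinner_sum_right cinner_cscale_right L_def super_kernel_def)
          then show "(\<Sum>p\<in>B. \<Sum>q\<in>B. M (i, p) (j, q) * L (i, p) (j, q))
              = cinner (\<psi> i) (\<Phi> (\<lambda>\<xi>. P N (R i j (P N \<xi>))) (\<psi> j))"
            by (simp add: sum.cartesian_product case_prod_beta)
        qed
        finally show "0 \<le> (\<Sum>i<n. \<Sum>j<n. cinner (\<psi> i) (\<Phi> (\<lambda>\<xi>. P N (R i j (P N \<xi>))) (\<psi> j)))" .
      qed
    qed
  qed
qed

text \<open>For the converse, the scalars in \<open>coherent_multiples\<close> come out of the
  kernel as weights \<open>c (fst s) * cnj (c (snd s))\<close>; then density of the span extends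
  positivity to all vectors.\<close>

lemma psd_kernel_super_coherent_iff:
  fixes \<Phi> :: "'m::finite operator \<Rightarrow> 'm operator"
  assumes \<Phi>: "superoperator \<Phi>"
  shows "psd_kernel UNIV (super_kernel \<Phi>) \<longleftrightarrow>
    psd_kernel UNIV (\<lambda>s t. super_kernel \<Phi> (map_prod coherent coherent s) (map_prod coherent coherent t))"
    (is "?L \<longleftrightarrow> ?R")
proof
  assume ?L
  then show ?R by (rule psd_kernel_comp) simp
next
  assume R: ?R
  have "\<forall>\<phi>\<in>coherent_multiples. \<exists>c z. \<phi> = cscale c (coherent z :: 'm fock)"
    by (auto simp: coherent_multiples_def)
  then obtain c z where cz: "\<And>\<phi> :: 'm fock. \<phi> \<in> coherent_multiples \<Longrightarrow> \<phi> = cscale (c \<phi>) (coherent (z \<phi>))"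
    by metis
  have "psd_kernel (coherent_multiples \<times> coherent_multiples) (super_kernel \<Phi>)"
  proof (rule psd_kernel_combination[OF R, where T = "\<lambda>s. {map_prod z z s}"
        and a = "\<lambda>s _. c (fst s) * cnj (c (snd s))"])
    fix s t :: "'m fock \<times> 'm fock"
    assume s: "s \<in> coherent_multiples \<times> coherent_multiples"
      and t: "t \<in> coherent_multiples \<times> coherent_multiples"
    define s' t' where "s' = map_prod coherent coherent (map_prod z z s)"
      and "t' = map_prod coherent coherent (map_prod z z t)"
    have eq: "fst s = cscale (c (fst s)) (fst s')" "snd s = cscale (c (snd s)) (snd s')"
        "fst t = cscale (c (fst t)) (fst t')" "snd t = cscale (c (snd t)) (snd t')"
      using s t cz by (auto simp: s'_def t'_def)
    have "super_kernel \<Phi> s t = super_kernel \<Phi> (cscale (c (fst s)) (fst s'), cscale (c (snd s)) (snd s'))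
        (cscale (c (fst t)) (fst t'), cscale (c (snd t)) (snd t'))"
      using eq by (metis prod.collapse)
    also have "\<dots> = cnj (c (fst s) * cnj (c (snd s))) * super_kernel \<Phi> s' t' * (c (fst t) * cnj (c (snd t)))"
      by (simp add: super_kernel_cscale[OF \<Phi>] mult_ac)
    finally show "super_kernel \<Phi> s t = (\<Sum>u\<in>{map_prod z z s}. \<Sum>u'\<in>{map_prod z z t}.
        cnj (c (fst s) * cnj (c (snd s))) *
        super_kernel \<Phi> (map_prod coherent coherent u) (map_prod coherent coherent u') *
        (c (fst t) * cnj (c (snd t))))"
      by (simp add: s'_def t'_def)
  qed auto
  then show ?L
    by (rule psd_kernel_super_dense[OF \<Phi> closure_span_coherent])
qed

subsection \<open>The Gaussian kernel\<close>

definition hform :: "complex ^ 'n ^ 'n \<Rightarrow> complex ^ 'n \<Rightarrow> complex ^ 'n \<Rightarrow> complex"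
  where "hform M u v = (\<Sum>i\<in>UNIV. \<Sum>j\<in>UNIV. cnj (u $ i) * M $ i $ j * v $ j)"

lemma positive_semidefinite_hform:
  "positive_semidefinite M \<longleftrightarrow> transpose (mat_cnj M) = M \<and> (\<forall>v. 0 \<le> hform M v v)"
  by (simp add: positive_semidefinite_def hform_def)

text \<open>The form at weights \<open>x\<close> is \<open>hform M y y\<close>, where
  \<open>y\<close> combines the vectors \<open>v s\<close> with conjugated weights. The conjugation
  matches the swapped order of \<open>s\<close> and \<open>t\<close> in the kernel.\<close>

lemma psd_kernel_hform:
  fixes M :: "complex ^ 'n::finite ^ 'n"
  assumes "\<And>v. 0 \<le> hform M v v"
  shows "psd_kernel X (\<lambda>s t. hform M (v t) (v s))"
  unfolding psd_kernel_def
proof (intro allI impI)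
  fix S and x :: "'a \<Rightarrow> complex"
  define y where "y = (\<chi> i. \<Sum>s\<in>S. cnj (x s) * v s $ i)"
  have "hform M y y = (\<Sum>i\<in>UNIV. \<Sum>j\<in>UNIV. \<Sum>t\<in>S. \<Sum>s\<in>S. cnj (x s) * (cnj (v t $ i) * M $ i $ j * v s $ j) * x t)"
    unfolding hform_def y_def
  proof (intro sum.cong[OF refl])
    fix i j
    have "cnj ((\<chi> i. \<Sum>s\<in>S. cnj (x s) * v s $ i) $ i) * M $ i $ j * (\<chi> i. \<Sum>s\<in>S. cnj (x s) * v s $ i) $ j
        = (\<Sum>t\<in>S. x t * cnj (v t $ i) * M $ i $ j) * (\<Sum>s\<in>S. cnj (x s) * v s $ j)"
      by (simp add: sum_distrib_right)
    also have "\<dots> = (\<Sum>t\<in>S. \<Sum>s\<in>S. cnj (x s) * (cnj (v t $ i) * M $ i $ j * v s $ j) * x t)"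
      unfolding sum_product by (intro sum.cong[OF refl]) (simp add: mult_ac)
    finally show "cnj ((\<chi> i. \<Sum>s\<in>S. cnj (x s) * v s $ i) $ i) * M $ i $ j * (\<chi> i. \<Sum>s\<in>S. cnj (x s) * v s $ i) $ j
        = (\<Sum>t\<in>S. \<Sum>s\<in>S. cnj (x s) * (cnj (v t $ i) * M $ i $ j * v s $ j) * x t)" .
  qed
  also have "\<dots> = (\<Sum>i\<in>UNIV. \<Sum>t\<in>S. \<Sum>j\<in>UNIV. \<Sum>s\<in>S. cnj (x s) * (cnj (v t $ i) * M $ i $ j * v s $ j) * x t)"
    by (rule sum.cong[OF refl], rule sum.swap)
  also have "\<dots> = (\<Sum>t\<in>S. \<Sum>i\<in>UNIV. \<Sum>j\<in>UNIV. \<Sum>s\<in>S. cnj (x s) * (cnj (v t $ i) * M $ i $ j * v s $ j) * x t)"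
    by (rule sum.swap)
  also have "\<dots> = (\<Sum>t\<in>S. \<Sum>i\<in>UNIV. \<Sum>s\<in>S. \<Sum>j\<in>UNIV. cnj (x s) * (cnj (v t $ i) * M $ i $ j * v s $ j) * x t)"
    by (rule sum.cong[OF refl], rule sum.cong[OF refl], rule sum.swap)
  also have "\<dots> = (\<Sum>t\<in>S. \<Sum>s\<in>S. \<Sum>i\<in>UNIV. \<Sum>j\<in>UNIV. cnj (x s) * (cnj (v t $ i) * M $ i $ j * v s $ j) * x t)"
    by (rule sum.cong[OF refl], rule sum.swap)
  also have "\<dots> = (\<Sum>s\<in>S. \<Sum>t\<in>S. \<Sum>i\<in>UNIV. \<Sum>j\<in>UNIV. cnj (x s) * (cnj (v t $ i) * M $ i $ j * v s $ j) * x t)"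
    by (rule sum.swap)
  also have "\<dots> = (\<Sum>s\<in>S. \<Sum>t\<in>S. cnj (x s) * hform M (v t) (v s) * x t)"
    by (intro sum.cong[OF refl]) (simp only: hform_def sum_distrib_left sum_distrib_right)
  finally show "0 \<le> (\<Sum>s\<in>S. \<Sum>t\<in>S. cnj (x s) * hform M (v t) (v s) * x t)"
    using assms[of y] by simp
qed

lemma psd_kernel_gaussian_iff:
  fixes M :: "complex ^ 'n::finite ^ 'n"
  assumes herm: "transpose (mat_cnj M) = M" and c: "c \<noteq> 0" and surj: "surj v"
  shows "psd_kernel UNIV (\<lambda>s t. c * exp (hform M (v t) (v s))) \<longleftrightarrow> positive_semidefinite M \<and> 0 \<le> c"
    (is "?L \<longleftrightarrow> ?R")
proof
  assume ?R
  then show ?L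
    by (intro psd_kernel_mult psd_kernel_const psd_kernel_exp psd_kernel_hform)
      (auto simp: positive_semidefinite_hform)
next
  assume L: ?L
  obtain o' where o': "v o' = 0" using surj by (metis surjD)
  have zero: "hform M u 0 = 0" "hform M 0 u = 0" for u by (simp_all add: hform_def)
  have c0: "0 \<le> c" using psd_kernel_diag[OF L, of o'] by (simp add: o' zero)
  then have "c = complex_of_real (Re c)" by (simp add: less_eq_complex_def complex_eq_iff)
  then have "0 \<le> 1 / c"
    using c0 by (metis complex_of_real_nonneg_iff divide_nonneg_nonneg of_real_1 of_real_divide zero_le_one)
  from psd_kernel_mult[OF psd_kernel_const[OF this] L]
  have E: "psd_kernel UNIV (\<lambda>s t. exp (hform M (v t) (v s)))" using c by simp
  have "0 \<le> hform M u u" for u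
  proof (cases "u = 0")
    case False
    obtain s where s: "v s = u" using surj by (metis surjD)
    then have "o' \<noteq> s" using False o' by auto
    \<comment> \<open>All entries that involve the origin equal \<open>exp 0 = 1\<close>, so these
      weights leave \<open>exp (hform M u u) - 1\<close>.\<close>
    from psd_kernel_pair[OF E _ _ this, of "- 1" 1]
    have 1: "0 \<le> exp (hform M u u) - 1" by (simp add: o' s zero)
    \<comment> \<open>Hermitian symmetry makes \<open>hform M u u\<close> real, which allows passing
      from the exponential back to its exponent.\<close>
    have "cnj (M $ i $ j) = M $ j $ i" for i j
      using herm by (simp add: transpose_def vec_eq_iff)
    then have "cnj (hform M u u) = hform M u u"
      unfolding hform_def by (simp add: mult_ac) (rule sum.swap)
    then have Im: "Im (hform M u u) = 0" by (simp add: complex_eq_iff)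
    then have "1 \<le> exp (Re (hform M u u))" using 1 by (simp add: less_eq_complex_def Re_exp)
    then show ?thesis using Im by (simp add: less_eq_complex_def)
  qed (simp add: zero)
  then show ?R using c0 herm by (simp add: positive_semidefinite_hform)
qed

section \<open>Block vectors and matrices, and the Abc form evaluated on coherent states\<close>

lemma vec_cnj_nth [simp]: "vec_cnj v $ i = cnj (v $ i)"
  by (simp add: vec_cnj_def)

lemma vec_cnj_vec_cnj [simp]: "vec_cnj (vec_cnj v) = v"
  by (simp add: vec_eq_iff)

lemma norm_vec_cnj: "norm (vec_cnj v) = norm v"
  by (simp add: norm_vec_def)

lemma vec_join_nth [simp]: "vec_join u v $ Inl i = u $ i" "vec_join u v $ Inr j = v $ j"
  by (simp_all add: vec_join_def)

lemma mat_block_nth [simp]: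
  "mat_block P Q R S $ Inl i $ Inl j = P $ i $ j" "mat_block P Q R S $ Inl i $ Inr k = Q $ i $ k"
  "mat_block P Q R S $ Inr l $ Inl j = R $ l $ j" "mat_block P Q R S $ Inr l $ Inr k = S $ l $ k"
  by (simp_all add: mat_block_def)

lemma vec_eq_join_iff: "x = vec_join u v \<longleftrightarrow> (\<forall>i. x $ Inl i = u $ i) \<and> (\<forall>j. x $ Inr j = v $ j)"
  by (simp add: vec_eq_iff split_sum_all)

lemma sum_UNIV_sum:
  "(\<Sum>i\<in>UNIV. f i) = (\<Sum>i\<in>UNIV. f (Inl i :: 'a::finite + 'b::finite)) + (\<Sum>j\<in>UNIV. f (Inr j))"
  by (simp add: UNIV_Plus_UNIV[symmetric] sum.Plus del: UNIV_Plus_UNIV)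

lemma vec_cnj_join: "vec_cnj (vec_join u v) = vec_join (vec_cnj u) (vec_cnj v)"
  by (simp add: vec_eq_join_iff)

lemma bilin_join: "bilin (vec_join u v) (vec_join u' v') = bilin u u' + bilin v v'"
  by (simp add: bilin_def sum_UNIV_sum)

lemma mat_block_mult: "mat_block P Q R S *v vec_join u v = vec_join (P *v u + Q *v v) (R *v u + S *v v)"
  by (simp add: vec_eq_join_iff matrix_vector_mult_def sum_UNIV_sum)

lemma bilin_vec_cnj: "bilin (vec_cnj u) (M *v v) = hform M u v"
  by (simp add: bilin_def hform_def matrix_vector_mult_def sum_distrib_left mult.assoc)

text \<open>At these points the exponent separates: the diagonal blocks and \<open>b\<close>
  contribute one function of \<open>s\<close> and its conjugate at \<open>t\<close>, which
  \<open>d\<close> collects together with the norms of the coherent labels. Only the blocks built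
  from \<open>\<Gamma>\<close> couple \<open>s\<close> and \<open>t\<close>.\<close>

lemma super_kernel_coherent:
  fixes \<Phi> :: "'m::finite operator \<Rightarrow> 'm operator"
  assumes abc: "abc_parametrization \<Phi> A b c"
    and A: "A = mat_block (mat_cnj \<Lambda>) \<Gamma> (mat_cnj \<Gamma>) \<Lambda>"
    and b: "b = vec_join (vec_cnj \<beta>) \<beta>"
    and herm: "transpose (mat_cnj \<Gamma>) = \<Gamma>"
  defines "v \<equiv> \<lambda>s :: (complex ^ 'm) \<times> (complex ^ 'm). vec_join (vec_cnj (fst s)) (snd s)"
  defines "d \<equiv> \<lambda>s :: (complex ^ 'm) \<times> (complex ^ 'm).
    complex_of_real (exp (- ((norm (fst s))\<^sup>2 + (norm (snd s))\<^sup>2) / 2)) *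
    cnj (exp (bilin (v s) (\<Lambda> *v v s) / 2 + bilin (v s) \<beta>))"
  shows "super_kernel \<Phi> (map_prod coherent coherent s) (map_prod coherent coherent t)
    = cnj (d s) * (c * exp (hform \<Gamma> (v t) (v s))) * d t"
proof -
  obtain a f a' f' where [simp]: "s = (a, f)" "t = (a', f')" by fastforce
  define K where "K = super_kernel \<Phi> (map_prod coherent coherent s) (map_prod coherent coherent t)"
  define r where "r = ((norm a)\<^sup>2 + (norm f)\<^sup>2) / 2"
  define r' where "r' = ((norm a')\<^sup>2 + (norm f')\<^sup>2) / 2"
  define g where "g x = bilin x (\<Lambda> *v x) / 2 + bilin x \<beta>" for x
  \<comment> \<open>Conjugating the second and third variables cancels the conjugations in
    \<open>bargmann\<close>, so its matrix element becomes that of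
    \<open>super_kernel\<close>.\<close>
  define \<zeta> where "\<zeta> = vec_join (vec_join a' (vec_cnj f')) (vec_join (vec_cnj a) f)"
  have \<zeta>: "\<zeta> = vec_join (vec_cnj (v t)) (v s)"
    by (simp add: \<zeta>_def v_def vec_cnj_join)
  \<comment> \<open>The block \<open>mat_cnj \<Gamma>\<close> thus contributes the same as the block
    \<open>\<Gamma>\<close>, and the factor one half in the exponent is used up.\<close>
  have swap: "bilin x (mat_cnj \<Gamma> *v vec_cnj y) = hform \<Gamma> y x" for x y
  proof -
    have "cnj (\<Gamma> $ i $ j) = \<Gamma> $ j $ i" for i j
      using herm by (simp add: transpose_def vec_eq_iff)
    then show ?thesis
      unfolding bilin_def hform_def matrix_vector_mult_def
      by (simp add: sum_distrib_left mult_ac) (rule sum.swap)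
  qed
  have conj: "bilin (vec_cnj x) (mat_cnj \<Lambda> *v vec_cnj x) = cnj (bilin x (\<Lambda> *v x))"
      "bilin (vec_cnj x) (vec_cnj \<beta>) = cnj (bilin x \<beta>)" for x
    by (simp_all add: bilin_def matrix_vector_mult_def)
  have add: "bilin x (y + z) = bilin x y + bilin x z" for x y z :: "complex ^ ('m + 'm)"
    by (simp add: bilin_def distrib_left sum.distrib)
  have "bilin \<zeta> (A *v \<zeta>) / 2 + bilin \<zeta> b = cnj (g (v t)) + g (v s) + hform \<Gamma> (v t) (v s)"
    by (simp add: A b \<zeta> mat_block_mult bilin_join add swap conj
        bilin_vec_cnj[where M = \<Gamma>] g_def field_simps)
  moreover have "bargmann \<Phi> a' (vec_cnj f') (vec_cnj a) f = c * exp (bilin \<zeta> (A *v \<zeta>) / 2 + bilin \<zeta> b)"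
    using abc by (simp add: abc_parametrization_def \<zeta>_def Let_def)
  moreover have "bargmann \<Phi> a' (vec_cnj f') (vec_cnj a) f = complex_of_real (exp (r + r')) * K"
    by (simp add: bargmann_def K_def super_kernel_def norm_vec_cnj r_def r'_def field_simps)
  ultimately have "complex_of_real (exp (r + r')) * K
      = c * (exp (cnj (g (v t))) * exp (g (v s)) * exp (hform \<Gamma> (v t) (v s)))"
    by (simp add: exp_add)
  then have "K = complex_of_real (exp (- r) * exp (- r')) *
      (c * (exp (cnj (g (v t))) * exp (g (v s)) * exp (hform \<Gamma> (v t) (v s))))"
    by (simp add: exp_add exp_minus field_simps)
  moreover have "d s = complex_of_real (exp (- r)) * cnj (exp (g (v s)))"
      "d t = complex_of_real (exp (- r')) * cnj (exp (g (v t)))"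
    by (simp_all add: d_def r_def r'_def g_def minus_divide_left)
  ultimately have "K = cnj (d s) * (c * exp (hform \<Gamma> (v t) (v s))) * d t"
    by (simp add: exp_cnj mult_ac)
  then show ?thesis by (simp only: K_def)
qed

theorem lemma1:
  fixes \<Phi> :: "'m::finite operator \<Rightarrow> 'm operator"
    and \<Lambda> \<Gamma> :: "complex ^ ('m + 'm) ^ ('m + 'm)"
    and \<beta> :: "complex ^ ('m + 'm)"
    and A :: "complex ^ (('m + 'm) + ('m + 'm)) ^ (('m + 'm) + ('m + 'm))"
    and b :: "complex ^ (('m + 'm) + ('m + 'm))"
    and c :: complex
  assumes "superoperator \<Phi>"
    and "abc_parametrization \<Phi> A b c"
    and "c \<noteq> 0"
    and "A = mat_block (mat_cnj \<Lambda>) \<Gamma> (mat_cnj \<Gamma>) \<Lambda>"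
    and "b = vec_join (vec_cnj \<beta>) \<beta>"
  shows "completely_positive \<Phi> \<longleftrightarrow> positive_semidefinite \<Gamma> \<and> 0 \<le> c"
proof -
  have sym: "transpose A = A" using assms(2) by (simp add: abc_parametrization_def)
  \<comment> \<open>Symmetry of \<open>A\<close> relates its two off-diagonal blocks, which are
    \<open>\<Gamma>\<close> and its conjugate; hence \<open>\<Gamma>\<close> is Hermitian.\<close>
  have "cnj (\<Gamma> $ j $ i) = \<Gamma> $ i $ j" for i j
  proof -
    have "cnj (\<Gamma> $ j $ i) = transpose A $ Inl i $ Inr j" by (simp add: transpose_def assms(4))
    also have "\<dots> = \<Gamma> $ i $ j" unfolding sym by (simp add: assms(4))
    finally show ?thesis .
  qed
  then have herm: "transpose (mat_cnj \<Gamma>) = \<Gamma>"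
    by (simp add: vec_eq_iff transpose_def)
  define v where "v s = vec_join (vec_cnj (fst s)) (snd s)" for s :: "(complex ^ 'm) \<times> (complex ^ 'm)"
  define d where "d s = complex_of_real (exp (- ((norm (fst s))\<^sup>2 + (norm (snd s))\<^sup>2) / 2)) *
      cnj (exp (bilin (v s) (\<Lambda> *v v s) / 2 + bilin (v s) \<beta>))" for s
  define G where "G s t = c * exp (hform \<Gamma> (v t) (v s))" for s t
  have nz: "d s \<noteq> 0" for s by (simp add: d_def)
  have "surj v"
  proof (rule surjI)
    show "v (vec_cnj (\<chi> i. x $ Inl i), \<chi> i. x $ Inr i) = x" for x
      by (simp add: v_def vec_eq_join_iff[THEN iffD2, symmetric])
  qed
  have "completely_positive \<Phi> \<longleftrightarrow> psd_kernel UNIV (\<lambda>s t. cnj (d s) * G s t * d t)"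
    unfolding completely_positive_iff_psd_kernel[OF assms(1)] psd_kernel_super_coherent_iff[OF assms(1)]
      super_kernel_coherent[OF assms(2,4,5) herm] G_def d_def v_def ..
  also have "\<dots> \<longleftrightarrow> psd_kernel UNIV G"
  proof
    \<comment> \<open>The factor \<open>d\<close> never vanishes, so rescaling by its inverse
      recovers \<open>G\<close>.\<close>
    assume "psd_kernel UNIV (\<lambda>s t. cnj (d s) * G s t * d t)"
    from psd_kernel_scale[OF this, of "\<lambda>s. 1 / d s"] show "psd_kernel UNIV G"
      using nz by simp
  qed (rule psd_kernel_scale)
  \<comment> \<open>Here \<open>c \<noteq> 0\<close> enters: for \<open>c = 0\<close> the kernel
    would vanish whatever \<open>\<Gamma>\<close> is.\<close>
  also have "\<dots> \<longleftrightarrow> positive_semidefinite \<Gamma> \<and> 0 \<le> c"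
    unfolding G_def by (rule psd_kernel_gaussian_iff[OF herm assms(3) \<open>surj v\<close>])
  finally show ?thesis .
qed

end
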